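(* Let $(b_n)_{n\ge0}$ be a monotone sequence with $b_n>0$, $b_n\to\infty$, $b_n/b_{n-1}\to1$ and $\sum_n b_n^{-1}=\infty$, let $0<B<1$, and let $a_n=\frac{1}{2B}\sqrt{b_nb_{n-1}}$ for $n\ge1$. Then the Jacobi matrix $J$ with $(b_n)_{n\ge0}$ on the main diagonal and $(a_n)_{n\ge1}$ on the two adjacent diagonals has absolutely continuous spectrum (spectral measure), and the associated orthonormal polynomials $(p_n)$ satisfy the local uniform estimate: for every compact interval $[a,b]\subset\mathbb R$ there is a constant $C$ such that $|p_n(x)|^2\le C\,b_n^{-1}$ for all $n$ and all $x\in[a,b]$.
   Context: The orthonormal polynomials associated with $J$ are defined by $p_{-1}=0$, $p_0=1$ and the three-term recurrence $xp_n(x)=a_{n+1}p_{n+1}(x)+b_np_n(x)+a_np_{n-1}(x)$, $n\ge0$; they are orthonormal in $L^2(\mu)$ where $\mu$ is the scalar spectral measure of the self-adjoint Jacobi matrix $J$. *)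

theory Defs
  imports "HOL-Analysis.Analysis"
begin

text \<open>Off-diagonal entries of the Jacobi matrix: a n = sqrt(b n * b (n-1)) / (2B) for n \<ge> 1
  (the value at n = 0 is irrelevant and never used).\<close>
definition jac_offdiag :: "real \<Rightarrow> (nat \<Rightarrow> real) \<Rightarrow> nat \<Rightarrow> real" where
  "jac_offdiag B b n = sqrt (b n * b (n - 1)) / (2 * B)"

text \<open>Orthonormal polynomials of the Jacobi matrix with off-diagonal a and diagonal b:
  p_{-1} = 0, p_0 = 1, x p_n = a_{n+1} p_{n+1} + b_n p_n + a_n p_{n-1}.\<close>
fun opoly :: "(nat \<Rightarrow> real) \<Rightarrow> (nat \<Rightarrow> real) \<Rightarrow> nat \<Rightarrow> real \<Rightarrow> real" where
  "opoly a b 0 x = 1"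
| "opoly a b (Suc 0) x = (x - b 0) / a 1"
| "opoly a b (Suc (Suc n)) x =
     ((x - b (Suc n)) * opoly a b (Suc n) x - a (Suc n) * opoly a b n x) / a (Suc (Suc n))"

text \<open>A Borel measure on the real line in L^2 of which the polynomials p_n are orthonormal
  (i.e. a spectral measure of J; unique in the determinate case).\<close>
definition orth_measure :: "(nat \<Rightarrow> real) \<Rightarrow> (nat \<Rightarrow> real) \<Rightarrow> real measure \<Rightarrow> bool" where
  "orth_measure a b M \<longleftrightarrow> sets M = sets borel \<and>
     (\<forall>n m. integrable M (\<lambda>x. opoly a b n x * opoly a b m x) \<and>
            (\<integral>x. opoly a b n x * opoly a b m x \<partial>M) = (if n = m then 1 else 0))"

end

(*
  Put v_n = sqrt(b_n) p_n(x). The special form of the a_n turns the three-term recurrence into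
  v_{n+1} + v_{n-1} = tau_n v_n with tau_n = -2B (1 - x/b_n), and tau_n is monotone in n with limit
  -2B, of modulus less than 2. Hence v_{n+1}^2 + v_n^2 - tau_n v_{n+1} v_n is eventually positive
  definite and changes by a summable relative amount, so that v stays bounded above, and (by the
  constancy of the Wronskian with a second solution) v_n^2 + v_{n+1}^2 stays bounded below, locally
  uniformly in x. The upper bound is the estimate |p_n|^2 <= C / b_n.

  For absolute continuity, let K_n(x,t) be the Christoffel-Darboux kernel and L_n the n-th partial
  sum of the divergent series of 1/b_k. The bounds give K_n(x,x) ~ L_n, and the same energy argument
  applied to v(t) - v(x) shows K_n(x,t) >= K_n(x,x)/2 as long as |t - x| L_n is small. Chebyshev's
  inequality for the square of K_n(x,.), whose integral is K_n(x,x), then yields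
  M[x-e, x+e] <= 4 / K_n(x,x) = O(e) when n is chosen with L_n ~ 1/e. This argument works for every
  orthogonality measure M, so that determinacy of the moment problem is not needed.

  Existence of an orthogonality measure holds for every Jacobi matrix: it is a weak limit of the
  Gauss quadrature measures carried by the zeros of p_n.
*)
theory Submission
  imports Defs "HOL-Probability.Probability" "HOL-Computational_Algebra.Fundamental_Theorem_Algebra"
    "Jordan_Normal_Form.Determinant"
begin

section \<open>Elliptic second-order recurrences\<close>

lemma discrete_gronwall:
  fixes e \<gamma> g :: "nat \<Rightarrow> real"
  assumes step: "\<And>k. k < n \<Longrightarrow> e (Suc k) \<le> (1 + \<gamma> k) * e k + g k"
    and nonneg: "\<And>k. 0 \<le> \<gamma> k" "\<And>k. 0 \<le> g k" "0 \<le> e 0"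
  shows "e n \<le> exp (\<Sum>k<n. \<gamma> k) * (e 0 + (\<Sum>k<n. g k))"
  using step
proof (induction n)
  case 0
  then show ?case by simp
next
  case (Suc n)
  let ?S = "\<Sum>k<n. \<gamma> k" and ?G = "e 0 + (\<Sum>k<n. g k)"
  have G: "0 \<le> ?G" using nonneg by (simp add: sum_nonneg)
  have "e (Suc n) \<le> (1 + \<gamma> n) * e n + g n" using Suc.prems by simp
  also have "\<dots> \<le> (1 + \<gamma> n) * (exp ?S * ?G) + g n"
    using Suc nonneg(1)[of n] by (intro add_right_mono mult_left_mono) auto
  \<comment> \<open>The inequality 1 + y <= exp y absorbs the growth factor; the new source term may
    be multiplied by an exponential that is at least 1.\<close>
  also have "\<dots> \<le> exp (\<gamma> n) * (exp ?S * ?G) + exp (?S + \<gamma> n) * g n"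
  proof (intro add_mono mult_right_mono)
    have "1 \<le> exp (?S + \<gamma> n)" using nonneg by (simp add: sum_nonneg)
    then show "g n \<le> exp (?S + \<gamma> n) * g n"
      using mult_right_mono[of 1 "exp (?S + \<gamma> n)" "g n"] nonneg(2)[of n] by simp
  qed (use G in auto)
  also have "\<dots> = exp (\<Sum>k<Suc n. \<gamma> k) * (e 0 + (\<Sum>k<Suc n. g k))"
    by (simp add: exp_add algebra_simps)
  finally show ?case .
qed

text \<open>For constant t this quadratic form is invariant under the transfer map (y, z) -> (t y -
  z, y). It is positive definite exactly when |t| < 2, the elliptic case.\<close>

definition energy :: "real \<Rightarrow> real \<Rightarrow> real \<Rightarrow> real" where
  "energy t y z = y\<^sup>2 + z\<^sup>2 - t * y * z"

lemma abs_mult_le_half_squares: "\<bar>y * z\<bar> \<le> (y\<^sup>2 + z\<^sup>2) / (2::real)"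
  using sum_squares_bound[of "\<bar>y\<bar>" "\<bar>z\<bar>"] by (simp add: abs_mult)

lemma energy_ge:
  assumes "\<bar>t\<bar> \<le> 2 * \<beta>"
  shows "(1 - \<beta>) * (y\<^sup>2 + z\<^sup>2) \<le> energy t y z"
proof -
  have "t * y * z \<le> \<bar>t\<bar> * \<bar>y * z\<bar>" by (metis abs_ge_self abs_mult mult.assoc)
  also have "\<dots> \<le> (2 * \<beta>) * ((y\<^sup>2 + z\<^sup>2) / 2)"
    using assms abs_mult_le_half_squares by (intro mult_mono) auto
  finally show ?thesis by (simp add: energy_def algebra_simps)
qed

lemma energy_nonneg: "\<bar>t\<bar> \<le> 2 \<Longrightarrow> 0 \<le> energy t y z"
  using energy_ge[of t 1 y z] by simp

text \<open>For |t| <= 2 the root of the energy is a seminorm in which (f, 0) has length |f|; this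
  is the triangle inequality.\<close>

lemma sqrt_energy_add:
  assumes "\<bar>t\<bar> \<le> 2"
  shows "sqrt (energy t (y + f) z) \<le> sqrt (energy t y z) + \<bar>f\<bar>"
proof -
  have E: "0 \<le> energy t y z" using assms by (rule energy_nonneg)
  have "t\<^sup>2 \<le> 2\<^sup>2" using assms by (intro abs_le_square_iff[THEN iffD1]) auto
  then have "t\<^sup>2 * z\<^sup>2 \<le> 4 * z\<^sup>2" by (intro mult_right_mono) auto
  \<comment> \<open>The difference of the two sides is (4 - t^2) z^2; this is Cauchy-Schwarz for the
    vectors (y, z) and (1, 0).\<close>
  then have "(2 * y - t * z)\<^sup>2 \<le> 4 * energy t y z"
    by (simp add: energy_def power2_eq_square algebra_simps)
  then have "\<bar>2 * y - t * z\<bar> \<le> sqrt (4 * energy t y z)"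
    by (metis real_sqrt_abs real_sqrt_le_iff)
  then have "\<bar>2 * y - t * z\<bar> \<le> 2 * sqrt (energy t y z)" by (simp add: real_sqrt_mult)
  then have "\<bar>f\<bar> * \<bar>2 * y - t * z\<bar> \<le> \<bar>f\<bar> * (2 * sqrt (energy t y z))"
    by (intro mult_left_mono) auto
  then have "f * (2 * y - t * z) \<le> \<bar>f\<bar> * (2 * sqrt (energy t y z))"
    by (metis abs_ge_self abs_mult order_trans)
  moreover have "energy t (y + f) z = energy t y z + f * (2 * y - t * z) + f\<^sup>2"
    by (simp add: energy_def power2_eq_square algebra_simps)
  ultimately have "energy t (y + f) z \<le> (sqrt (energy t y z) + \<bar>f\<bar>)\<^sup>2"
    using E by (simp add: power2_sum algebra_simps)
  then show ?thesis using E by (intro real_le_lsqrt) auto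
qed

text \<open>Replacing t by t' changes the form by at most |t' - t| (y^2 + z^2) / 2, which
  \<open>energy_ge\<close> bounds by a multiple of the energy itself, so the loss is a relative
  one.\<close>

lemma energy_variation:
  assumes "\<bar>t\<bar> \<le> 2 * \<beta>" "\<beta> < 1" "\<bar>t'\<bar> \<le> 2 * \<beta>"
  shows "sqrt (energy t' y z) \<le> (1 + \<bar>t' - t\<bar> / (2 * (1 - \<beta>))) * sqrt (energy t y z)"
proof -
  let ?g = "\<bar>t' - t\<bar> / (2 * (1 - \<beta>))"
  have g: "0 \<le> ?g" using assms by simp
  have E: "0 \<le> energy t y z" using assms by (intro energy_nonneg) auto
  have "energy t' y z = energy t y z - (t' - t) * (y * z)"
    by (simp add: energy_def algebra_simps)
  also have "\<dots> \<le> energy t y z + \<bar>t' - t\<bar> * \<bar>y * z\<bar>"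
    by (metis abs_ge_minus_self abs_mult add_left_mono diff_conv_add_uminus)
  also have "\<dots> \<le> energy t y z + \<bar>t' - t\<bar> * ((y\<^sup>2 + z\<^sup>2) / 2)"
    by (intro add_left_mono mult_left_mono abs_mult_le_half_squares) auto
  also have "\<bar>t' - t\<bar> * ((y\<^sup>2 + z\<^sup>2) / 2) = ?g * ((1 - \<beta>) * (y\<^sup>2 + z\<^sup>2))"
    using assms by (simp add: field_simps)
  also have "energy t y z + \<dots> \<le> energy t y z + ?g * energy t y z"
    using assms g by (intro add_left_mono mult_left_mono energy_ge) auto
  also have "\<dots> \<le> (1 + ?g)\<^sup>2 * energy t y z"
  proof -
    have "1 + ?g \<le> (1 + ?g)\<^sup>2" by (rule self_le_power) (use g in auto)
    then have "(1 + ?g) * energy t y z \<le> (1 + ?g)\<^sup>2 * energy t y z"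
      using E by (rule mult_right_mono)
    then show ?thesis by (simp add: algebra_simps)
  qed
  finally have "sqrt (energy t' y z) \<le> sqrt ((1 + ?g)\<^sup>2 * energy t y z)" by simp
  then show ?thesis using g by (simp add: real_sqrt_mult)
qed

text \<open>Each step exchanges the coefficient \<open>\<tau> k\<close> for
  \<open>\<tau> (Suc k)\<close>, a relative loss, then applies the transfer map, which preserves the
  energy, and finally adds \<open>f k\<close>. Gronwall's inequality collects the losses into the
  total variation of \<open>\<tau>\<close>.\<close>

lemma recurrence_bound_elliptic:
  fixes d f \<tau> :: "nat \<Rightarrow> real"
  assumes \<tau>: "\<And>k. \<bar>\<tau> k\<bar> \<le> 2 * \<beta>" and \<beta>: "\<beta> < 1"
    and V: "\<And>n. (\<Sum>k<n. \<bar>\<tau> (Suc k) - \<tau> k\<bar>) \<le> V"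
    and d: "\<And>k. d (Suc (Suc k)) = \<tau> (Suc k) * d (Suc k) - d k + f k"
  shows "\<bar>d n\<bar> + \<bar>d (Suc n)\<bar> \<le> sqrt (2 / (1 - \<beta>)) * exp (V / (2 * (1 - \<beta>))) *
           (\<bar>d 0\<bar> + \<bar>d (Suc 0)\<bar> + (\<Sum>k<n. \<bar>f k\<bar>))"
proof -
  define e where "e k = sqrt (energy (\<tau> k) (d (Suc k)) (d k))" for k
  define \<gamma> where "\<gamma> k = \<bar>\<tau> (Suc k) - \<tau> k\<bar> / (2 * (1 - \<beta>))" for k
  have \<tau>2: "\<bar>\<tau> k\<bar> \<le> 2" for k using \<tau>[of k] \<beta> by linarith
  have "e (Suc k) \<le> (1 + \<gamma> k) * e k + \<bar>f k\<bar>" for k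
  proof -
    have "e (Suc k) = sqrt (energy (\<tau> (Suc k)) ((\<tau> (Suc k) * d (Suc k) - d k) + f k) (d (Suc k)))"
      by (simp add: e_def d)
    also have "\<dots> \<le> sqrt (energy (\<tau> (Suc k)) (\<tau> (Suc k) * d (Suc k) - d k) (d (Suc k))) + \<bar>f k\<bar>"
      by (rule sqrt_energy_add[OF \<tau>2])
    also have "energy (\<tau> (Suc k)) (\<tau> (Suc k) * d (Suc k) - d k) (d (Suc k))
        = energy (\<tau> (Suc k)) (d (Suc k)) (d k)"
      by (simp add: energy_def power2_eq_square algebra_simps)
    also have "sqrt \<dots> \<le> (1 + \<gamma> k) * e k"
      unfolding e_def \<gamma>_def using \<tau> \<beta> by (intro energy_variation)
    finally show ?thesis by simp
  qed
  moreover have "0 \<le> \<gamma> k" for k using \<beta> by (simp add: \<gamma>_def)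
  moreover have "0 \<le> e 0" using energy_nonneg[OF \<tau>2] by (simp add: e_def)
  ultimately have "e n \<le> exp (\<Sum>k<n. \<gamma> k) * (e 0 + (\<Sum>k<n. \<bar>f k\<bar>))"
    by (intro discrete_gronwall) auto
  also have "\<dots> \<le> exp (V / (2 * (1 - \<beta>))) * ((\<bar>d 0\<bar> + \<bar>d (Suc 0)\<bar>) + (\<Sum>k<n. \<bar>f k\<bar>))"
  proof (intro mult_mono add_right_mono)
    show "exp (\<Sum>k<n. \<gamma> k) \<le> exp (V / (2 * (1 - \<beta>)))"
      using V[of n] \<beta> by (simp add: \<gamma>_def sum_divide_distrib[symmetric] divide_right_mono)
    have "- (\<tau> 0 * d (Suc 0) * d 0) \<le> \<bar>\<tau> 0\<bar> * \<bar>d (Suc 0) * d 0\<bar>"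
      by (metis abs_ge_minus_self abs_mult mult.assoc)
    also have "\<dots> \<le> 2 * \<bar>d (Suc 0) * d 0\<bar>" by (intro mult_right_mono \<tau>2) auto
    finally have "energy (\<tau> 0) (d (Suc 0)) (d 0) \<le> (\<bar>d 0\<bar> + \<bar>d (Suc 0)\<bar>)\<^sup>2"
      by (simp add: energy_def power2_sum abs_mult algebra_simps)
    then show "e 0 \<le> \<bar>d 0\<bar> + \<bar>d (Suc 0)\<bar>"
      unfolding e_def by (intro real_le_lsqrt) (auto intro: energy_nonneg \<tau>2)
    show "0 \<le> e 0 + (\<Sum>k<n. \<bar>f k\<bar>)" using \<open>0 \<le> e 0\<close> by (simp add: sum_nonneg)
  qed auto
  finally have e: "e n \<le> exp (V / (2 * (1 - \<beta>))) * (\<bar>d 0\<bar> + \<bar>d (Suc 0)\<bar> + (\<Sum>k<n. \<bar>f k\<bar>))" .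
  \<comment> \<open>The return from energy to values: the 2 comes from (|y| + |z|)^2 <= 2 (y^2 +
    z^2), the denominator \<open>1 - \<beta>\<close> from ellipticity.\<close>
  have "(\<bar>d n\<bar> + \<bar>d (Suc n)\<bar>)\<^sup>2 \<le> 2 * ((d (Suc n))\<^sup>2 + (d n)\<^sup>2)"
    using sum_squares_bound[of "\<bar>d n\<bar>" "\<bar>d (Suc n)\<bar>"] by (simp add: power2_sum algebra_simps)
  also have "\<dots> = 2 / (1 - \<beta>) * ((1 - \<beta>) * ((d (Suc n))\<^sup>2 + (d n)\<^sup>2))" using \<beta> by simp
  also have "\<dots> \<le> 2 / (1 - \<beta>) * energy (\<tau> n) (d (Suc n)) (d n)"
    using \<beta> by (intro mult_left_mono energy_ge \<tau>) auto
  finally have "\<bar>d n\<bar> + \<bar>d (Suc n)\<bar> \<le> sqrt (2 / (1 - \<beta>)) * e n"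
    unfolding e_def real_sqrt_mult[symmetric] by (intro real_le_rsqrt)
  also have "\<dots> \<le> sqrt (2 / (1 - \<beta>)) *
      (exp (V / (2 * (1 - \<beta>))) * (\<bar>d 0\<bar> + \<bar>d (Suc 0)\<bar> + (\<Sum>k<n. \<bar>f k\<bar>)))"
    using \<beta> e by (intro mult_left_mono) auto
  finally show ?thesis by (simp add: mult.assoc)
qed

text \<open>Ellipticity is available from index \<open>N\<close> on. The first \<open>N\<close>
  steps cost a factor 1 + A each, at most exp (A N) in total, and the elliptic estimate is then
  started at \<open>N\<close>.\<close>

lemma recurrence_bound:
  fixes d f \<tau> :: "nat \<Rightarrow> real"
  assumes A: "\<And>k. \<bar>\<tau> k\<bar> \<le> A" and \<tau>: "\<And>k. N \<le> k \<Longrightarrow> \<bar>\<tau> k\<bar> \<le> 2 * \<beta>" and \<beta>: "0 \<le> \<beta>" "\<beta> < 1"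
    and V: "\<And>n. (\<Sum>k<n. \<bar>\<tau> (Suc k) - \<tau> k\<bar>) \<le> V"
    and d: "\<And>k. d (Suc (Suc k)) = \<tau> (Suc k) * d (Suc k) - d k + f k"
  shows "\<bar>d n\<bar> + \<bar>d (Suc n)\<bar> \<le> sqrt (2 / (1 - \<beta>)) * exp (V / (2 * (1 - \<beta>))) * exp (A * real N) *
           (\<bar>d 0\<bar> + \<bar>d (Suc 0)\<bar> + (\<Sum>k<n. \<bar>f k\<bar>))"
proof -
  define s where "s k = \<bar>d k\<bar> + \<bar>d (Suc k)\<bar>" for k
  define K where "K = sqrt (2 / (1 - \<beta>)) * exp (V / (2 * (1 - \<beta>)))"
  have A0: "0 \<le> A" using A[of 0] by linarith
  have V0: "0 \<le> V" using V[of 0] by simp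
  have K1: "1 \<le> K"
  proof -
    have "1 \<le> sqrt (2 / (1 - \<beta>))" using \<beta> by (simp add: field_simps)
    moreover have "1 \<le> exp (V / (2 * (1 - \<beta>)))" using V0 \<beta> by simp
    ultimately show ?thesis unfolding K_def by (metis mult_mono' mult_1 zero_le_one)
  qed
  have s0: "0 \<le> s k" for k by (simp add: s_def)
  have step: "s (Suc k) \<le> (1 + A) * s k + \<bar>f k\<bar>" for k
  proof -
    have "\<bar>d (Suc (Suc k))\<bar> \<le> \<bar>\<tau> (Suc k) * d (Suc k)\<bar> + \<bar>d k\<bar> + \<bar>f k\<bar>" unfolding d by linarith
    also have "\<bar>\<tau> (Suc k) * d (Suc k)\<bar> \<le> A * \<bar>d (Suc k)\<bar>"
      unfolding abs_mult by (intro mult_right_mono A) auto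
    finally have "\<bar>d (Suc (Suc k))\<bar> \<le> A * \<bar>d (Suc k)\<bar> + \<bar>d k\<bar> + \<bar>f k\<bar>" by simp
    moreover have "0 \<le> A * \<bar>d k\<bar>" using A0 by simp
    ultimately show ?thesis by (simp add: s_def algebra_simps)
  qed
  have small: "s n \<le> exp (A * real N) * (s 0 + (\<Sum>k<n. \<bar>f k\<bar>))" if "n \<le> N" for n
  proof -
    have "s n \<le> exp (\<Sum>k<n. A) * (s 0 + (\<Sum>k<n. \<bar>f k\<bar>))"
      by (rule discrete_gronwall) (use step A0 s0 in auto)
    also have "\<dots> \<le> exp (A * real N) * (s 0 + (\<Sum>k<n. \<bar>f k\<bar>))"
      using that A0 s0[of 0]
      by (intro mult_right_mono add_nonneg_nonneg sum_nonneg) (auto simp: mult.commute mult_left_mono)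
    finally show ?thesis .
  qed
  have "s n \<le> K * exp (A * real N) * (s 0 + (\<Sum>k<n. \<bar>f k\<bar>))"
  proof (cases "n \<le> N")
    case True
    have "1 * (exp (A * real N) * (s 0 + (\<Sum>k<n. \<bar>f k\<bar>))) \<le> K * (exp (A * real N) * (s 0 + (\<Sum>k<n. \<bar>f k\<bar>)))"
      using K1 s0[of 0] by (intro mult_right_mono mult_nonneg_nonneg add_nonneg_nonneg sum_nonneg) auto
    with small[OF True] show ?thesis unfolding mult.assoc mult_1 by (rule order_trans)
  next
    case False
    then obtain m where n: "n = N + m" by (metis le_iff_add nat_le_linear)
    \<comment> \<open>The shifted coefficients have no larger total variation, so the same
      \<open>V\<close> serves the tail.\<close>
    have "(\<Sum>k<n. \<bar>\<tau> (N + Suc k) - \<tau> (N + k)\<bar>) \<le> V" for n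
    proof -
      have "(\<Sum>k<n. \<bar>\<tau> (N + Suc k) - \<tau> (N + k)\<bar>) = (\<Sum>k\<in>(+) N ` {..<n}. \<bar>\<tau> (Suc k) - \<tau> k\<bar>)"
        by (simp add: sum.reindex)
      also have "\<dots> \<le> (\<Sum>k<N + n. \<bar>\<tau> (Suc k) - \<tau> k\<bar>)" by (intro sum_mono2) auto
      finally show ?thesis using V[of "N + n"] by linarith
    qed
    then have "\<bar>d (N + m)\<bar> + \<bar>d (N + Suc m)\<bar> \<le> K *
        (\<bar>d (N + 0)\<bar> + \<bar>d (N + Suc 0)\<bar> + (\<Sum>k<m. \<bar>f (N + k)\<bar>))"
      unfolding K_def using \<tau> \<beta>
      by (intro recurrence_bound_elliptic[where \<tau> = "\<lambda>k. \<tau> (N + k)"]) (auto simp: d)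
    then have "s n \<le> K * (s N + (\<Sum>k<m. \<bar>f (N + k)\<bar>))" by (simp add: s_def n)
    \<comment> \<open>Enlarging the tail sum by the same exponential allows both source sums to be
      merged into one.\<close>
    also have "(\<Sum>k<m. \<bar>f (N + k)\<bar>) \<le> exp (A * real N) * (\<Sum>k<m. \<bar>f (N + k)\<bar>)"
      using mult_right_mono[of 1 "exp (A * real N)" "\<Sum>k<m. \<bar>f (N + k)\<bar>"] A0
      by (simp add: sum_nonneg)
    also have "s N \<le> exp (A * real N) * (s 0 + (\<Sum>k<N. \<bar>f k\<bar>))" by (rule small) simp
    finally have "s n \<le> K * (exp (A * real N) * (s 0 + (\<Sum>k<N. \<bar>f k\<bar>)) +
        exp (A * real N) * (\<Sum>k<m. \<bar>f (N + k)\<bar>))"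
      using K1 by (simp add: mult_left_mono)
    also have "\<dots> = K * exp (A * real N) * (s 0 + ((\<Sum>k<N. \<bar>f k\<bar>) + (\<Sum>k<m. \<bar>f (N + k)\<bar>)))"
      by (simp add: algebra_simps)
    also have "(\<Sum>k<N. \<bar>f k\<bar>) + (\<Sum>k<m. \<bar>f (N + k)\<bar>) = (\<Sum>k<n. \<bar>f k\<bar>)"
      unfolding n by (induction m) auto
    finally show ?thesis .
  qed
  then show ?thesis by (simp add: K_def s_def)
qed

section \<open>Local bounds and absolute continuity\<close>

lemma partial_sums_unbounded:
  fixes g :: "nat \<Rightarrow> real"
  assumes "\<And>k. 0 \<le> g k" "\<not> summable g"
  shows "\<exists>n. y < (\<Sum>k<n. g k)"
proof (rule ccontr)
  assume "\<not> ?thesis"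
  then have "\<And>n. (\<Sum>k<n. norm (g k)) \<le> y" using assms(1) by (simp add: not_less)
  then have "summable g"
    using bounded_imp_summable[of g y] assms(1) by (metis lessThan_Suc_atMost real_norm_def abs_of_nonneg sum.cong)
  with assms(2) show False by simp
qed

text \<open>A null set is covered by nonoverlapping intervals of small total length, and the bound
  carries the smallness over to \<open>M\<close>. As the bound is local, bounded pieces of the null
  set are treated first.\<close>

lemma absolutely_continuous_if_interval_bound:
  fixes M :: "real measure"
  assumes fin: "finite_measure M" and sets: "sets M = sets borel"
    and bound: "\<And>X. \<exists>C. \<forall>c d. - X \<le> c \<longrightarrow> c \<le> d \<longrightarrow> d \<le> X \<longrightarrow> measure M {c..d} \<le> C * (d - c)"
  shows "absolutely_continuous lborel M"
proof -
  interpret finite_measure M by (rule fin)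
  have null: "S \<in> null_sets M" if S: "S \<in> null_sets lborel" "S \<subseteq> {- X..X}" for S X
  proof -
    obtain C' where C': "\<And>c d. \<lbrakk>- X \<le> c; c \<le> d; d \<le> X\<rbrakk> \<Longrightarrow> measure M {c..d} \<le> C' * (d - c)"
      using bound by blast
    \<comment> \<open>The maximum makes the constant positive, so that a covering with excess
      \<open>e / C\<close> can be requested.\<close>
    define C where "C = max C' 1"
    have C: "C > 0" by (simp add: C_def)
    have bnd: "measure M {c..d} \<le> C * (d - c)" if "- X \<le> c" "c \<le> d" "d \<le> X" for c d
      using C'[OF that] mult_right_mono[of C' C "d - c"] that by (simp add: C_def)
    have Sb: "S \<in> sets borel" using S by auto
    have "S \<in> null_sets lebesgue" using S(1) by (rule null_sets_completionI)
    then have Sl: "S \<in> lmeasurable" "measure lebesgue S = 0"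
      by (auto intro: negligible_imp_measurable simp: negligible_iff_null_sets
          measure_eq_0_null_sets)
    have "measure M S \<le> 0"
    proof (rule field_le_epsilon)
      fix e :: real assume e: "e > 0"
      obtain \<D> where \<D>: "countable \<D>"
        "\<And>K. K \<in> \<D> \<Longrightarrow> K \<subseteq> cbox (- X) X \<and> K \<noteq> {} \<and> (\<exists>c d. K = cbox c d)"
        "pairwise (\<lambda>A B. interior A \<inter> interior B = {}) \<D>"
        "S \<subseteq> \<Union>\<D>" "\<Union>\<D> \<in> lmeasurable" "measure lebesgue (\<Union>\<D>) \<le> measure lebesgue S + e / C"
      proof (rule measurable_outer_intervals_bounded[OF Sl(1), of "- X" X "e / C"])
        show "S \<subseteq> cbox (- X) X" using S(2) by simp
        show "0 < e / C" using e C by simp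
      qed (rule that)
      have \<D>b: "K \<in> sets M" if "K \<in> \<D>" for K using \<D>(2)[OF that] sets by auto
      \<comment> \<open>Finitely many of the intervals form a division, so their lengths add up
        exactly to the measure of their union.\<close>
      have fin_bound: "measure M (\<Union>\<F>) \<le> e" if \<F>: "finite \<F>" "\<F> \<subseteq> \<D>" for \<F>
      proof -
        have div: "\<F> division_of \<Union>\<F>"
        proof (rule division_ofI)
          fix K assume "K \<in> \<F>"
          then show "K \<subseteq> \<Union>\<F>" "K \<noteq> {}" "\<exists>a b. K = cbox a b" using \<F> \<D>(2)[of K] by auto
        next
          fix K1 K2 assume "K1 \<in> \<F>" "K2 \<in> \<F>" "K1 \<noteq> K2"
          then show "interior K1 \<inter> interior K2 = {}" using \<F> \<D>(3) unfolding pairwise_def by blast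
        qed (use \<F> in auto)
        have "measure M (\<Union>\<F>) \<le> (\<Sum>K\<in>\<F>. measure M K)"
          using finite_measure_subadditive_finite[of \<F> "\<lambda>K. K"] \<F> \<D>b by auto
        also have "\<dots> \<le> (\<Sum>K\<in>\<F>. C * measure lebesgue K)"
        proof (rule sum_mono)
          fix K assume "K \<in> \<F>"
          then have "K \<in> \<D>" using \<F> by blast
          then obtain c d where cd: "K = cbox c d" and sub: "K \<subseteq> cbox (- X) X" and ne: "K \<noteq> {}"
            using \<D>(2) by metis
          have K: "K = {c..d}" "c \<le> d" "K \<subseteq> {- X..X}" using cd sub ne by auto
          then show "measure M K \<le> C * measure lebesgue K" using bnd[of c d] by auto
        qed
        also have "\<dots> = C * measure lebesgue (\<Union>\<F>)"
          unfolding content_division[OF div, symmetric] by (rule sum_distrib_left[symmetric])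
        also have "\<dots> \<le> C * (e / C)"
        proof (rule mult_left_mono)
          have "measure lebesgue (\<Union>\<F>) \<le> measure lebesgue (\<Union>\<D>)"
            using \<F> \<D>(5) div by (intro measure_mono_fmeasurable Union_mono) (auto dest: lmeasurable_division)
          then show "measure lebesgue (\<Union>\<F>) \<le> e / C" using \<D>(6) Sl(2) by linarith
        qed (use C in simp)
        finally show ?thesis using C by simp
      qed
      show "measure M S \<le> 0 + e"
      proof (cases "\<D> = {}")
        case True
        then show ?thesis using \<D>(4) e by simp
      next
        case False
        \<comment> \<open>An enumeration of the countable family transfers the bound from finite
          unions to the full union, by continuity from below.\<close>
        define K where "K = from_nat_into \<D>"
        have K: "range K = \<D>" using False \<D>(1) by (simp add: K_def)
        define U where "U n = \<Union>(K ` {..n})" for n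
        have "(\<lambda>n. measure M (U n)) \<longlonglongrightarrow> measure M (\<Union>n. U n)"
        proof (rule finite_Lim_measure_incseq)
          show "range U \<subseteq> sets M" 
          proof (rule image_subsetI)
            fix n show "U n \<in> sets M"
              unfolding U_def by (rule sets.finite_Union) (use K \<D>b in auto)
          qed
          show "incseq U" unfolding U_def incseq_def by (intro allI impI Union_mono image_mono) simp
        qed
        moreover have "measure M (U n) \<le> e" for n
          unfolding U_def using K by (intro fin_bound) auto
        ultimately have "measure M (\<Union>n. U n) \<le> e" by (intro LIMSEQ_le_const2) auto
        moreover have "(\<Union>n. U n) = \<Union>\<D>" unfolding U_def K[symmetric] by auto
        moreover have "measure M S \<le> measure M (\<Union>\<D>)"
          using \<D>(1,4) \<D>b by (intro finite_measure_mono sets.countable_Union) auto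
        ultimately show ?thesis by simp
      qed
    qed
    then have "measure M S = 0" using measure_nonneg[of M S] by linarith
    then show ?thesis using Sb sets by (simp add: null_sets_def emeasure_eq_measure)
  qed
  show ?thesis
    unfolding absolutely_continuous_def
  proof
    fix S :: "real set" assume S: "S \<in> null_sets lborel"
    have "(\<Union>n::nat. S \<inter> {- real n..real n}) \<in> null_sets M"
    proof (rule null_sets_UN)
      fix n :: nat
      have "S \<inter> {- real n..real n} \<in> null_sets lborel" using S by (intro null_set_Int2) auto
      then show "S \<inter> {- real n..real n} \<in> null_sets M" by (rule null[where X = "real n"]) auto
    qed
    also have "(\<Union>n::nat. S \<inter> {- real n..real n}) = S"
    proof -
      have "x \<in> (\<Union>n::nat. {- real n..real n})" for x :: real
      proof -
        obtain n :: nat where "\<bar>x\<bar> \<le> real n" using real_arch_simple by blast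
        then have "x \<in> {- real n..real n}" by auto
        then show ?thesis by blast
      qed
      then show ?thesis by auto
    qed
    finally show "S \<in> null_sets M" .
  qed
qed

text \<open>As p_0 = 1, the integrability of its square makes the measure finite and its unit norm
  makes the total mass 1.\<close>

lemma orth_measure_prob_space:
  assumes "orth_measure a b M"
  shows "prob_space M"
proof -
  have "integrable M (\<lambda>x. opoly a b 0 x * opoly a b 0 x)"
    "(\<integral>x. opoly a b 0 x * opoly a b 0 x \<partial>M) = 1"
    using assms unfolding orth_measure_def by presburger+
  then have fin: "integrable M (\<lambda>x. 1 :: real)" and one: "measure M (space M) = 1" by auto
  then interpret finite_measure M by (simp add: integrable_iff_bounded finite_measureI less_top)
  show ?thesis using one by (intro prob_spaceI) (simp add: emeasure_eq_measure)
qed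

lemma isCont_opoly: "isCont (opoly a b n) x"
proof (induction a b n x rule: opoly.induct)
  case (1 a b x)
  have "opoly a b 0 = (\<lambda>_. 1)" by auto
  then show ?case by simp
next
  case (2 a b x)
  have "opoly a b (Suc 0) = (\<lambda>x. (x - b 0) / a 1)" by auto
  \<comment> \<open>If \<open>a 1\<close> is 0, division by zero gives the value 0, and the function
    is constant, hence still continuous.\<close>
  then show ?case by (cases "a 1 = 0") auto
next
  case (3 a b n x)
  have "opoly a b (Suc (Suc n)) = (\<lambda>x. ((x - b (Suc n)) * opoly a b (Suc n) x - a (Suc n) * opoly a b n x) / a (Suc (Suc n)))"
    by auto
  with 3 show ?case by (cases "a (Suc (Suc n)) = 0") auto
qed

lemma measurable_opoly [measurable]: "opoly a b n \<in> borel_measurable borel"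
  by (intro borel_measurable_continuous_onI continuous_at_imp_continuous_on) (simp add: isCont_opoly)

section \<open>The rescaled recurrence for v_n and its locally uniform bounds\<close>

locale jacobi_weights =
  fixes b :: "nat \<Rightarrow> real" and B :: real
  assumes inc: "incseq b"
    and pos: "\<And>n. b n > 0"
    and infty: "filterlim b at_top sequentially"
    and B: "0 < B" "B < 1"
begin

abbreviation "a \<equiv> jac_offdiag B b"
abbreviation "p \<equiv> opoly a b"

definition \<tau> :: "real \<Rightarrow> nat \<Rightarrow> real" where
  "\<tau> x k = - 2 * B * (1 - x / b k)"

definition v :: "real \<Rightarrow> nat \<Rightarrow> real" where
  "v x n = sqrt (b n) * p n x"

definition L :: "nat \<Rightarrow> real" where
  "L n = (\<Sum>k<n. 1 / b k)"

definition K :: "nat \<Rightarrow> real \<Rightarrow> real \<Rightarrow> real" where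
  "K n x y = (\<Sum>k<n. p k x * p k y)"

lemma b_nz [simp]: "b n \<noteq> 0" "0 \<le> b n" "\<not> b n \<le> 0" "\<not> b n < 0" "0 < b n"
  using pos[of n] by linarith+

lemma b_ge_b0: "b 0 \<le> b n"
  using inc by (simp add: incseq_def)

lemma p_v: "p n x = v x n / sqrt (b n)"
  by (simp add: v_def)

lemma K_v: "K n x y = (\<Sum>k<n. v x k * v y k / b k)"
  unfolding K_def p_v by (intro sum.cong) auto

lemma v_0: "v x 0 = sqrt (b 0)"
  by (simp add: v_def)

text \<open>This is the recurrence at index 0 with v_{-1} = 0, so the first value obeys the same law
  as the later ones.\<close>

lemma v_1: "v x (Suc 0) = \<tau> x 0 * sqrt (b 0)"
proof -
  have "\<tau> x 0 * sqrt (b 0) = 2 * B * (x - b 0) * (sqrt (b 0) / b 0)"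
    by (simp add: \<tau>_def field_simps)
  also have "sqrt (b 0) / b 0 = 1 / sqrt (b 0)"
    using real_sqrt_mult_self[of "b 0"] by (simp add: field_simps del: real_sqrt_mult_self)
  also have "2 * B * (x - b 0) * (1 / sqrt (b 0)) = v x (Suc 0)"
    using B by (simp add: v_def jac_offdiag_def real_sqrt_mult)
  finally show ?thesis by simp
qed

text \<open>Since 2 B a_n = sqrt (b_n) sqrt (b_{n-1}), multiplying the three-term recurrence by 2 B
  produces the factor sqrt (b_{k+1}) in every term; it is carried along and cancelled at the
  end.\<close>

lemma v_rec: "v x (Suc (Suc k)) = \<tau> x (Suc k) * v x (Suc k) - v x k"
proof -
  have sq: "b (Suc k) = sqrt (b (Suc k)) * sqrt (b (Suc k))" by simp
  have "sqrt (b (Suc k)) * v x (Suc (Suc k)) = 2 * B * (a (Suc (Suc k)) * p (Suc (Suc k)) x)"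
    using B by (simp add: v_def jac_offdiag_def real_sqrt_mult)
  also have "a (Suc (Suc k)) * p (Suc (Suc k)) x = (x - b (Suc k)) * p (Suc k) x - a (Suc k) * p k x"
    using B by (simp add: jac_offdiag_def)
  also have "2 * B * \<dots> = 2 * B * ((x - b (Suc k)) * p (Suc k) x) - sqrt (b (Suc k)) * v x k"
    using B by (simp add: v_def jac_offdiag_def real_sqrt_mult right_diff_distrib)
  also have "2 * B * ((x - b (Suc k)) * p (Suc k) x) = \<tau> x (Suc k) * (b (Suc k) * p (Suc k) x)"
    by (simp add: \<tau>_def field_simps)
  also have "b (Suc k) * p (Suc k) x = sqrt (b (Suc k)) * v x (Suc k)"
    by (simp add: v_def mult.assoc[symmetric])
  finally have "sqrt (b (Suc k)) * v x (Suc (Suc k)) =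
      sqrt (b (Suc k)) * (\<tau> x (Suc k) * v x (Suc k) - v x k)"
    by (simp add: algebra_simps)
  then show ?thesis by simp
qed

text \<open>The threshold \<open>N\<close>, the bound \<open>A\<close> and the variation bound
  \<open>V\<close> of the coefficients depend on x only through |x| <= \<open>Y\<close>, which makes
  the constant uniform. The source \<open>f\<close> serves the comparison of two spectral
  parameters.\<close>

lemma stability:
  obtains C where "C > 0"
    "\<And>x d f n. \<lbrakk>\<bar>x\<bar> \<le> X; \<And>k. d (Suc (Suc k)) = \<tau> x (Suc k) * d (Suc k) - d k + f k\<rbrakk>
       \<Longrightarrow> \<bar>d n\<bar> + \<bar>d (Suc n)\<bar> \<le> C * (\<bar>d 0\<bar> + \<bar>d (Suc 0)\<bar> + (\<Sum>k<n. \<bar>f k\<bar>))"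
proof -
  define Y where "Y = max X 1"
  have Y: "0 < Y" "\<And>x. \<bar>x\<bar> \<le> X \<Longrightarrow> \<bar>x\<bar> \<le> Y" by (auto simp: Y_def)
  \<comment> \<open>A value strictly between B and 1: the gap \<open>\<beta> - B\<close> has to
    accommodate the term B Y / b_k for k >= \<open>N\<close>.\<close>
  define \<beta> where "\<beta> = (1 + B) / 2"
  have \<beta>: "B < \<beta>" "\<beta> < 1" "0 \<le> \<beta>" using B by (auto simp: \<beta>_def)
  define A where "A = 2 * (1 + Y / b 0)"
  define V where "V = 2 * Y / b 0"
  have \<tau>_le: "\<bar>\<tau> x k\<bar> \<le> 2 * B * (1 + Y / b k)" if "\<bar>x\<bar> \<le> X" for x k
  proof -
    have "\<bar>1 - x / b k\<bar> \<le> 1 + \<bar>x\<bar> / b k" using abs_triangle_ineq4[of 1 "x / b k"] by simp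
    also have "\<dots> \<le> 1 + Y / b k" using Y(2)[OF that] by (simp add: divide_right_mono)
    finally have "2 * B * \<bar>1 - x / b k\<bar> \<le> 2 * B * (1 + Y / b k)" using B by (intro mult_left_mono) auto
    then show ?thesis using B by (simp add: \<tau>_def abs_mult)
  qed
  have "\<forall>\<^sub>F k in sequentially. B * Y / (\<beta> - B) \<le> b k"
    using infty by (simp add: filterlim_at_top)
  then obtain N where N: "\<And>k. N \<le> k \<Longrightarrow> B * Y / (\<beta> - B) \<le> b k"
    by (auto simp: eventually_sequentially)
  have \<tau>A: "\<bar>\<tau> x k\<bar> \<le> A" if "\<bar>x\<bar> \<le> X" for x k
  proof -
    have "Y / b k \<le> Y / b 0" using Y(1) b_ge_b0[of k] by (intro divide_left_mono) auto
    then have "B * (1 + Y / b k) \<le> 1 * (1 + Y / b 0)" using B Y(1) by (intro mult_mono) auto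
    then show ?thesis using \<tau>_le[OF that, of k] unfolding A_def by linarith
  qed
  have \<tau>\<beta>: "\<bar>\<tau> x k\<bar> \<le> 2 * \<beta>" if "\<bar>x\<bar> \<le> X" "N \<le> k" for x k
  proof -
    have "B * Y / b k \<le> \<beta> - B" using N[OF that(2)] \<beta>(1) by (simp add: field_simps)
    then have "B * (1 + Y / b k) \<le> \<beta>" by (simp add: algebra_simps)
    then show ?thesis using \<tau>_le[OF that(1), of k] by linarith
  qed
  have \<tau>V: "(\<Sum>k<n. \<bar>\<tau> x (Suc k) - \<tau> x k\<bar>) \<le> V" if "\<bar>x\<bar> \<le> X" for x n
  proof -
    \<comment> \<open>As 1 / b_k decreases, the absolute differences are plain differences and their
      sum telescopes.\<close>
    have "\<bar>\<tau> x (Suc k) - \<tau> x k\<bar> \<le> 2 * Y * (1 / b k - 1 / b (Suc k))" for k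
    proof -
      have le: "1 / b (Suc k) \<le> 1 / b k" using inc by (intro divide_left_mono) (auto simp: incseq_Suc_iff)
      have "\<tau> x (Suc k) - \<tau> x k = - (2 * (B * x) * (1 / b k - 1 / b (Suc k)))"
        by (simp add: \<tau>_def algebra_simps)
      then have "\<bar>\<tau> x (Suc k) - \<tau> x k\<bar> = 2 * (B * \<bar>x\<bar>) * (1 / b k - 1 / b (Suc k))"
        using le B by (simp add: abs_mult)
      also have "\<dots> \<le> 2 * (1 * Y) * (1 / b k - 1 / b (Suc k))"
        using le B Y(2)[OF that] by (intro mult_right_mono mult_left_mono mult_mono) auto
      finally show ?thesis by simp
    qed
    then have "(\<Sum>k<n. \<bar>\<tau> x (Suc k) - \<tau> x k\<bar>) \<le> (\<Sum>k<n. 2 * Y * (1 / b k - 1 / b (Suc k)))"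
      by (intro sum_mono) auto
    also have "\<dots> = 2 * Y * (1 / b 0 - 1 / b n)"
      by (simp only: sum_distrib_left[symmetric] sum_lessThan_telescope'[of "\<lambda>k. 1 / b k"])
    also have "\<dots> \<le> V" using Y(1) by (simp add: V_def algebra_simps)
    finally show ?thesis .
  qed
  show ?thesis
  proof (rule that)
    show "0 < sqrt (2 / (1 - \<beta>)) * exp (V / (2 * (1 - \<beta>))) * exp (A * real N)"
      using \<beta> by simp
  qed (rule recurrence_bound[where \<beta> = \<beta> and N = N and A = A and V = V]; use \<tau>A \<tau>\<beta> \<tau>V \<beta> in auto)
qed

lemma v_upper:
  obtains C where "C > 0" "\<And>x n. \<bar>x\<bar> \<le> X \<Longrightarrow> \<bar>v x n\<bar> \<le> C"
proof -
  obtain C where C: "C > 0" "\<And>x d f n. \<lbrakk>\<bar>x\<bar> \<le> X; \<And>k. d (Suc (Suc k)) = \<tau> x (Suc k) * d (Suc k) - d k + f k\<rbrakk>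
       \<Longrightarrow> \<bar>d n\<bar> + \<bar>d (Suc n)\<bar> \<le> C * (\<bar>d 0\<bar> + \<bar>d (Suc 0)\<bar> + (\<Sum>k<n. \<bar>f k\<bar>))"
    using stability by blast
  \<comment> \<open>The bracket bounds |v_0| + |v_1|, since v_0 = sqrt (b_0) and v_1 =
    \<open>\<tau> x 0\<close> v_0; \<open>stability\<close> is applied with zero source.\<close>
  define D where "D = C * (sqrt (b 0) + 2 * (1 + \<bar>X\<bar> / b 0) * sqrt (b 0))"
  show ?thesis
  proof (rule that)
    show "0 < D" using C(1) by (simp add: D_def add_pos_nonneg)
    fix x n assume x: "\<bar>x\<bar> \<le> X"
    have "\<bar>1 - x / b 0\<bar> \<le> 1 + \<bar>x\<bar> / b 0" using abs_triangle_ineq4[of 1 "x / b 0"] by simp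
    also have "\<dots> \<le> 1 + \<bar>X\<bar> / b 0" using x by (simp add: divide_right_mono)
    finally have "2 * (B * \<bar>1 - x / b 0\<bar>) \<le> 2 * (1 * (1 + \<bar>X\<bar> / b 0))"
      using B by (intro mult_mono) auto
    then have \<tau>0: "\<bar>\<tau> x 0\<bar> \<le> 2 * (1 + \<bar>X\<bar> / b 0)" using B by (simp add: \<tau>_def abs_mult)
    have "\<bar>v x n\<bar> + \<bar>v x (Suc n)\<bar> \<le> C * (\<bar>v x 0\<bar> + \<bar>v x (Suc 0)\<bar>)"
      using C(2)[OF x, where d = "v x" and f = "\<lambda>_. 0"] v_rec by simp
    also have "\<dots> \<le> D"
      unfolding D_def v_0 v_1 abs_mult using C(1) \<tau>0 by (intro mult_left_mono add_mono mult_right_mono) auto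
    finally show "\<bar>v x n\<bar> \<le> D" by simp
  qed
qed

text \<open>A multiple of the rescaled polynomials of the second kind; it is the partner of v in the
  Wronskian.\<close>

fun second_solution :: "real \<Rightarrow> nat \<Rightarrow> real" where
  "second_solution x 0 = 0"
| "second_solution x (Suc 0) = 1"
| "second_solution x (Suc (Suc k)) = \<tau> x (Suc k) * second_solution x (Suc k) - second_solution x k"

text \<open>The transfer matrices have determinant 1, so the Wronskian keeps its initial value v_0 *
  1 - v_1 * 0.\<close>

lemma v_wronskian: "v x n * second_solution x (Suc n) - v x (Suc n) * second_solution x n = sqrt (b 0)"
proof (induction n)
  case 0
  then show ?case by (simp add: v_0)
next
  case (Suc n)
  then show ?case by (simp add: v_rec algebra_simps)
qed

text \<open>The second solution is bounded, so two neighbouring values of v cannot both be small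
  while the Wronskian keeps its fixed positive value.\<close>

lemma v_lower:
  obtains c where "c > 0" "\<And>x n. \<bar>x\<bar> \<le> X \<Longrightarrow> c \<le> (v x n)\<^sup>2 + (v x (Suc n))\<^sup>2"
proof -
  obtain C where C: "C > 0" "\<And>x d f n. \<lbrakk>\<bar>x\<bar> \<le> X; \<And>k. d (Suc (Suc k)) = \<tau> x (Suc k) * d (Suc k) - d k + f k\<rbrakk>
       \<Longrightarrow> \<bar>d n\<bar> + \<bar>d (Suc n)\<bar> \<le> C * (\<bar>d 0\<bar> + \<bar>d (Suc 0)\<bar> + (\<Sum>k<n. \<bar>f k\<bar>))"
    using stability by blast
  show ?thesis
  proof (rule that)
    show "0 < b 0 / (2 * C\<^sup>2)" using C by simp
    fix x n assume x: "\<bar>x\<bar> \<le> X"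
    let ?r = "second_solution x"
    have r: "\<bar>?r n\<bar> + \<bar>?r (Suc n)\<bar> \<le> C"
      using C(2)[OF x, where d = ?r and f = "\<lambda>_. 0"] by simp
    have "sqrt (b 0) \<le> \<bar>v x n\<bar> * \<bar>?r (Suc n)\<bar> + \<bar>v x (Suc n)\<bar> * \<bar>?r n\<bar>"
      unfolding v_wronskian[symmetric, of x n] abs_mult[symmetric] by linarith
    also have "\<dots> \<le> \<bar>v x n\<bar> * C + \<bar>v x (Suc n)\<bar> * C"
      using r by (intro add_mono mult_left_mono) auto
    finally have "(sqrt (b 0))\<^sup>2 \<le> (C * (\<bar>v x n\<bar> + \<bar>v x (Suc n)\<bar>))\<^sup>2"
      by (intro power_mono) (auto simp: algebra_simps)
    also have "\<dots> = C\<^sup>2 * (\<bar>v x n\<bar> + \<bar>v x (Suc n)\<bar>)\<^sup>2" by (simp add: power_mult_distrib)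
    also have "\<dots> \<le> C\<^sup>2 * (2 * ((v x n)\<^sup>2 + (v x (Suc n))\<^sup>2))"
      using sum_squares_bound[of "\<bar>v x n\<bar>" "\<bar>v x (Suc n)\<bar>"]
      by (intro mult_left_mono) (auto simp: power2_sum algebra_simps)
    finally show "b 0 / (2 * C\<^sup>2) \<le> (v x n)\<^sup>2 + (v x (Suc n))\<^sup>2"
      using C(1) by (simp add: field_simps)
  qed
qed

text \<open>The difference v(t) - v(x) solves the recurrence at x with source 2 B (t - x) v_k(t) /
  b_k, and \<open>stability\<close> turns the sum of the sources into a multiple of |t - x|
  L_n.\<close>

lemma v_lipschitz:
  obtains C where "C > 0" "\<And>x t n. \<lbrakk>\<bar>x\<bar> \<le> X; \<bar>t\<bar> \<le> X\<rbrakk> \<Longrightarrow> \<bar>v t n - v x n\<bar> \<le> C * \<bar>t - x\<bar> * L n"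
proof -
  obtain C where C: "C > 0" "\<And>x d f n. \<lbrakk>\<bar>x\<bar> \<le> X; \<And>k. d (Suc (Suc k)) = \<tau> x (Suc k) * d (Suc k) - d k + f k\<rbrakk>
       \<Longrightarrow> \<bar>d n\<bar> + \<bar>d (Suc n)\<bar> \<le> C * (\<bar>d 0\<bar> + \<bar>d (Suc 0)\<bar> + (\<Sum>k<n. \<bar>f k\<bar>))"
    using stability by blast
  obtain D where D: "D > 0" "\<And>x n. \<bar>x\<bar> \<le> X \<Longrightarrow> \<bar>v x n\<bar> \<le> D" using v_upper by blast
  have \<tau>diff: "\<tau> t k - \<tau> x k = 2 * B * (t - x) / b k" for t x k
    by (simp add: \<tau>_def field_simps)
  show ?thesis
  proof (rule that)
    show "0 < C * (2 * D)" using C D by simp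
    fix x t n assume xt: "\<bar>x\<bar> \<le> X" "\<bar>t\<bar> \<le> X"
    define d where "d k = v t k - v x k" for k
    have inc_le: "\<bar>2 * B * (t - x) / b k * v t k'\<bar> \<le> 2 * D * \<bar>t - x\<bar> * (1 / b k)" for k k'
    proof -
      have "B * (\<bar>t - x\<bar> / b k) * \<bar>v t k'\<bar> \<le> 1 * (\<bar>t - x\<bar> / b k) * D"
        using B D xt by (intro mult_mono) auto
      moreover have "\<bar>2 * B * (t - x) / b k * v t k'\<bar> = 2 * (B * (\<bar>t - x\<bar> / b k) * \<bar>v t k'\<bar>)"
        using B by (simp add: abs_mult)
      ultimately have "\<bar>2 * B * (t - x) / b k * v t k'\<bar> \<le> 2 * (1 * (\<bar>t - x\<bar> / b k) * D)" by linarith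
      then show ?thesis by (simp add: mult_ac)
    qed
    show "\<bar>v t n - v x n\<bar> \<le> C * (2 * D) * \<bar>t - x\<bar> * L n"
    proof (cases n)
      case 0
      then show ?thesis by (simp add: v_0 L_def)
    next
      case (Suc m)
      have "\<bar>d m\<bar> + \<bar>d (Suc m)\<bar> \<le> C * (\<bar>d 0\<bar> + \<bar>d (Suc 0)\<bar> +
          (\<Sum>k<m. \<bar>2 * B * (t - x) / b (Suc k) * v t (Suc k)\<bar>))"
      proof (rule C(2)[OF xt(1)])
        fix k
        show "d (Suc (Suc k)) = \<tau> x (Suc k) * d (Suc k) - d k + 2 * B * (t - x) / b (Suc k) * v t (Suc k)"
          unfolding \<tau>diff[symmetric] by (simp add: d_def v_rec algebra_simps)
      qed
      also have "d 0 = 0" by (simp add: d_def v_0)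
      \<comment> \<open>The initial difference is the source term of index 0, exactly the one that
        the shifted sum lacks.\<close>
      also have "d (Suc 0) = 2 * B * (t - x) / b 0 * v t 0"
        unfolding \<tau>diff[symmetric] by (simp add: d_def v_0 v_1 algebra_simps)
      also have "\<bar>0\<bar> + \<bar>2 * B * (t - x) / b 0 * v t 0\<bar> + (\<Sum>k<m. \<bar>2 * B * (t - x) / b (Suc k) * v t (Suc k)\<bar>)
          = (\<Sum>k<Suc m. \<bar>2 * B * (t - x) / b k * v t k\<bar>)"
        by (simp only: sum.lessThan_Suc_shift abs_zero add_0)
      also have "\<dots> \<le> (\<Sum>k<Suc m. 2 * D * \<bar>t - x\<bar> * (1 / b k))"
        by (intro sum_mono inc_le)
      also have "\<dots> = 2 * D * \<bar>t - x\<bar> * L n" by (simp only: L_def Suc sum_distrib_left)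
      finally show ?thesis using C(1) by (simp add: d_def Suc mult.assoc)
    qed
  qed
qed

lemma poly_bound: "\<exists>C. \<forall>n. \<forall>x\<in>{l..u}. (p n x)\<^sup>2 \<le> C / b n"
proof -
  obtain C where C: "C > 0" "\<And>x n. \<bar>x\<bar> \<le> max \<bar>l\<bar> \<bar>u\<bar> \<Longrightarrow> \<bar>v x n\<bar> \<le> C" using v_upper by blast
  have "(p n x)\<^sup>2 \<le> C\<^sup>2 / b n" if "x \<in> {l..u}" for n x
  proof -
    have "\<bar>v x n\<bar>\<^sup>2 \<le> C\<^sup>2" using that by (intro power_mono C(2)) auto
    then show ?thesis by (simp add: p_v power_divide divide_right_mono)
  qed
  then show ?thesis by blast
qed

section \<open>The Christoffel-Darboux kernel and the mass of small intervals\<close>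

lemma K_measurable: "K n x \<in> borel_measurable borel"
  unfolding K_def by measurable

text \<open>Parseval's identity: K_n(x, .) has the coefficients p_k(x), k < n, in an orthonormal
  system.\<close>

lemma K_square_integral:
  assumes "orth_measure a b M"
  shows "integrable M (\<lambda>t. (K n x t)\<^sup>2)" "(\<integral>t. (K n x t)\<^sup>2 \<partial>M) = K n x x"
proof -
  have int: "integrable M (\<lambda>t. p k t * p l t)"
    and orth: "(\<integral>t. p k t * p l t \<partial>M) = (if k = l then 1 else 0)" for k l
    using assms by (auto simp: orth_measure_def)
  have eq: "(K n x t)\<^sup>2 = (\<Sum>k<n. \<Sum>l<n. p k x * p l x * (p k t * p l t))" for t
    unfolding K_def power2_eq_square sum_product by (simp add: mult_ac)
  show "integrable M (\<lambda>t. (K n x t)\<^sup>2)"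
    unfolding eq by (intro Bochner_Integration.integrable_sum integrable_mult_right int)
  have "(\<integral>t. (K n x t)\<^sup>2 \<partial>M) = (\<Sum>k<n. \<Sum>l<n. p k x * p l x * (\<integral>t. p k t * p l t \<partial>M))"
    unfolding eq
    by (subst Bochner_Integration.integral_sum,
        (intro Bochner_Integration.integrable_sum integrable_mult_right int),
        intro sum.cong refl,
        subst Bochner_Integration.integral_sum,
        (intro integrable_mult_right int),
        intro sum.cong refl, simp)
  also have "\<dots> = (\<Sum>k<n. \<Sum>l<n. if k = l then p k x * p l x else 0)"
    unfolding orth by (intro sum.cong) auto
  also have "\<dots> = K n x x" unfolding K_def by (intro sum.cong) auto
  finally show "(\<integral>t. (K n x t)\<^sup>2 \<partial>M) = K n x x" .
qed

text \<open>Dividing the lower bound on v_k^2 + v_{k+1}^2 by b_{k+1} >= b_k leaves at most two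
  neighbouring summands of K_n(x, x), and each summand is used at most twice.\<close>

lemma L_le_K:
  obtains \<kappa> where "\<kappa> > 0" "\<And>x n. \<lbrakk>\<bar>x\<bar> \<le> X; 0 < n\<rbrakk> \<Longrightarrow> L n \<le> \<kappa> * K n x x"
proof -
  obtain c where c: "c > 0" "\<And>x n. \<bar>x\<bar> \<le> X \<Longrightarrow> c \<le> (v x n)\<^sup>2 + (v x (Suc n))\<^sup>2" using v_lower by blast
  show ?thesis
  proof (rule that)
    show "0 < 1 / b 0 + 2 / c" using c(1) by (simp add: add_pos_pos)
    fix x n assume x: "\<bar>x\<bar> \<le> X" and "0 < (n::nat)"
    then obtain m where n: "n = Suc m" by (metis Suc_pred)
    define w where "w k = (v x k)\<^sup>2 / b k" for k
    have w0: "0 \<le> w k" for k by (simp add: w_def)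
    have K: "K n x x = (\<Sum>k<n. w k)" by (simp add: K_v w_def power2_eq_square)
    have shift: "(\<Sum>k<Suc m. g k) = g 0 + (\<Sum>k<m. g (Suc k))" for g :: "nat \<Rightarrow> real"
      by (rule sum.lessThan_Suc_shift)
    have "w 0 = 1" by (simp add: w_def v_0)
    then have K1: "1 \<le> K n x x" unfolding K unfolding n shift using w0 by (simp add: sum_nonneg)
    have "c * (1 / b (Suc k)) \<le> w k + w (Suc k)" for k
    proof -
      have "c * (1 / b (Suc k)) \<le> ((v x k)\<^sup>2 + (v x (Suc k))\<^sup>2) / b (Suc k)"
        using c(2)[OF x, of k] by (simp add: divide_right_mono)
      also have "\<dots> = (v x k)\<^sup>2 / b (Suc k) + w (Suc k)" by (simp add: w_def add_divide_distrib)
      also have "(v x k)\<^sup>2 / b (Suc k) \<le> w k"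
        unfolding w_def using inc by (intro divide_left_mono) (auto simp: incseq_Suc_iff)
      finally show ?thesis by simp
    qed
    then have "(\<Sum>k<m. c * (1 / b (Suc k))) \<le> (\<Sum>k<m. w k + w (Suc k))" by (intro sum_mono)
    also have "\<dots> = (\<Sum>k<m. w k) + (\<Sum>k<m. w (Suc k))" by (rule sum.distrib)
    also have "\<dots> \<le> K n x x + K n x x"
      unfolding K unfolding n using w0[of m] w0[of 0] shift[of w] by (intro add_mono) auto
    finally have "c * (\<Sum>k<m. 1 / b (Suc k)) \<le> 2 * K n x x"
      unfolding sum_distrib_left[symmetric] by simp
    then have "(\<Sum>k<m. 1 / b (Suc k)) \<le> 2 / c * K n x x"
      using c(1) by (simp add: pos_le_divide_eq mult.commute)
    \<comment> \<open>The pairing starts at 1 / b_1; the remaining 1 / b_0 is absorbed through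
      K_n(x, x) >= 1, which comes from p_0 = 1.\<close>
    then have "L n \<le> 1 / b 0 + 2 / c * K n x x" unfolding L_def n shift by simp
    also have "\<dots> \<le> 1 / b 0 * K n x x + 2 / c * K n x x" using K1 by (simp add: divide_right_mono)
    finally show "L n \<le> (1 / b 0 + 2 / c) * K n x x" by (simp add: algebra_simps)
  qed
qed


lemma orth_measure_small_interval:
  assumes M: "orth_measure a b M" and div: "\<not> summable (\<lambda>n. 1 / b n)"
  obtains C where "C > 0" "\<And>x \<epsilon>. \<lbrakk>\<bar>x\<bar> \<le> X; 0 < \<epsilon>\<rbrakk> \<Longrightarrow> measure M {x - \<epsilon>..x + \<epsilon>} \<le> C * \<epsilon>"
proof -
  interpret prob_space M using M by (rule orth_measure_prob_space)
  have sets [measurable_cong]: "sets M = sets borel" using M by (simp add: orth_measure_def)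
  then have space: "space M = UNIV" by (metis sets_eq_imp_space_eq space_borel)
  \<comment> \<open>The extra 1 keeps the whole interval around x inside the region of the bounds as
    soon as \<epsilon> <= 1.\<close>
  define Y where "Y = \<bar>X\<bar> + 1"
  obtain C\<^sub>1 where C1: "C\<^sub>1 > 0" "\<And>x n. \<bar>x\<bar> \<le> Y \<Longrightarrow> \<bar>v x n\<bar> \<le> C\<^sub>1" using v_upper by blast
  obtain C\<^sub>2 where C2: "C\<^sub>2 > 0"
      "\<And>x t n. \<lbrakk>\<bar>x\<bar> \<le> Y; \<bar>t\<bar> \<le> Y\<rbrakk> \<Longrightarrow> \<bar>v t n - v x n\<bar> \<le> C\<^sub>2 * \<bar>t - x\<bar> * L n"
    using v_lipschitz by blast
  obtain \<kappa> where \<kappa>: "\<kappa> > 0" "\<And>x n. \<lbrakk>\<bar>x\<bar> \<le> Y; 0 < n\<rbrakk> \<Longrightarrow> L n \<le> \<kappa> * K n x x" using L_le_K by blast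
  \<comment> \<open>Chosen so that \<open>C\<^sub>1 * C\<^sub>2 * \<delta> * \<kappa>\<close> is
    1/2; K_n(x, t) then deviates from K_n(x, x) by at most half of the latter.\<close>
  define \<delta> where "\<delta> = 1 / (2 * C\<^sub>1 * C\<^sub>2 * \<kappa>)"
  \<comment> \<open>The second entry gives 1 / b_0 <= \<delta> / (2 \<epsilon>), which limits the
    overshoot in the choice of n below.\<close>
  define \<epsilon>\<^sub>0 where "\<epsilon>\<^sub>0 = min 1 (\<delta> * b 0 / 2)"
  have \<delta>: "\<delta> > 0" using C1 C2 \<kappa> by (simp add: \<delta>_def)
  then have \<epsilon>0: "\<epsilon>\<^sub>0 > 0" by (simp add: \<epsilon>\<^sub>0_def)
  \<comment> \<open>The second entry covers \<epsilon> > \<open>\<epsilon>\<^sub>0\<close>, where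
    the total mass 1 already gives the bound.\<close>
  define C where "C = max (8 * \<kappa> / \<delta>) (1 / \<epsilon>\<^sub>0)"
  have L_mono: "L m \<le> L n" if "m \<le> n" for m n
    unfolding L_def using that by (intro sum_mono2) auto
  show ?thesis
  proof (rule that)
    show "0 < C" using \<epsilon>0 by (simp add: C_def less_max_iff_disj)
    fix x \<epsilon> :: real assume x: "\<bar>x\<bar> \<le> X" and \<epsilon>: "0 < \<epsilon>"
    let ?J = "{x - \<epsilon>..x + \<epsilon>}"
    show "measure M ?J \<le> C * \<epsilon>"
    proof (cases "\<epsilon> \<le> \<epsilon>\<^sub>0")
      case False
      then have "1 \<le> 1 / \<epsilon>\<^sub>0 * \<epsilon>" using \<epsilon>0 by simp
      also have "\<dots> \<le> C * \<epsilon>" using \<epsilon> by (intro mult_right_mono) (auto simp: C_def)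
      finally show ?thesis using prob_le_1[of ?J] by linarith
    next
      case True
      then have \<epsilon>1: "\<epsilon> \<le> 1" and \<epsilon>b: "\<epsilon> \<le> \<delta> * b 0 / 2" by (auto simp: \<epsilon>\<^sub>0_def)
      define P where "P n \<longleftrightarrow> \<delta> / \<epsilon> < L n" for n
      have "\<exists>n. P n"
        unfolding P_def L_def using partial_sums_unbounded[OF _ div] by simp
      then have PL: "P (LEAST n. P n)" by (rule LeastI_ex)
      have "\<not> P 0" using divide_pos_pos[OF \<delta> \<epsilon>] by (simp add: P_def L_def)
      then obtain n where n: "(LEAST n. P n) = Suc n" using PL by (metis not0_implies_Suc)
      \<comment> \<open>\<open>Suc n\<close> is the first index at which L exceeds \<delta> /
        \<epsilon>, so L_n does not. The last increment 1 / b_n is at most half of that threshold,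
        so L_n still exceeds the other half.\<close>
      have Ln: "L n \<le> \<delta> / \<epsilon>" using not_less_Least[of n P] n by (simp add: P_def)
      have "\<delta> / \<epsilon> < L n + 1 / b n" using PL n by (simp add: P_def L_def)
      moreover have "1 / b n \<le> 1 / b 0" using b_ge_b0[of n] by (intro divide_left_mono) auto
      moreover have "1 / b 0 \<le> \<delta> / (2 * \<epsilon>)" using \<epsilon>b \<epsilon> by (simp add: field_simps)
      moreover have "\<delta> / \<epsilon> = \<delta> / (2 * \<epsilon>) + \<delta> / (2 * \<epsilon>)" by (simp add: field_simps)
      ultimately have Ln': "\<delta> / (2 * \<epsilon>) < L n" by linarith
      moreover have "0 < \<delta> / (2 * \<epsilon>)" using \<delta> \<epsilon> by simp
      ultimately have Lpos: "0 < L n" by linarith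
      then have n0: "0 < n" by (cases n) (auto simp: L_def)
      have xY: "\<bar>x\<bar> \<le> Y" using x by (simp add: Y_def)
      have LK: "L n \<le> \<kappa> * K n x x" using \<kappa>(2)[OF xY n0] .
      then have Kpos: "0 < K n x x" using Lpos \<kappa>(1) using zero_less_mult_pos[of \<kappa> "K n x x"] by linarith
      have Q: "K n x x / 2 \<le> \<bar>K n x t\<bar>" if t: "t \<in> ?J" for t
      proof -
        have tx: "\<bar>t - x\<bar> \<le> \<epsilon>" using t by auto
        then have tY: "\<bar>t\<bar> \<le> Y" using x \<epsilon>1 by (simp add: Y_def)
        have "\<bar>K n x t - K n x x\<bar> = \<bar>\<Sum>k<n. v x k * (v t k - v x k) / b k\<bar>"
          by (simp add: K_v sum_subtractf[symmetric] algebra_simps diff_divide_distrib)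
        also have "\<dots> \<le> (\<Sum>k<n. \<bar>v x k * (v t k - v x k) / b k\<bar>)" by (rule sum_abs)
        also have "\<dots> \<le> (\<Sum>k<n. C\<^sub>1 * (C\<^sub>2 * \<epsilon> * L n) * (1 / b k))"
        proof (rule sum_mono)
          fix k assume k: "k \<in> {..<n}"
          have L0: "0 \<le> L k" by (auto simp: L_def intro!: sum_nonneg)
          have "\<bar>v t k - v x k\<bar> \<le> C\<^sub>2 * \<bar>t - x\<bar> * L k" by (rule C2(2)[OF xY tY])
          also have "\<dots> \<le> C\<^sub>2 * \<epsilon> * L n"
            using C2(1) tx \<epsilon> L0 L_mono[of k n] k by (intro mult_mono) auto
          finally have "\<bar>v x k\<bar> * \<bar>v t k - v x k\<bar> \<le> C\<^sub>1 * (C\<^sub>2 * \<epsilon> * L n)"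
            using C1 xY by (intro mult_mono) auto
          then have "\<bar>v x k\<bar> * \<bar>v t k - v x k\<bar> / b k \<le> C\<^sub>1 * (C\<^sub>2 * \<epsilon> * L n) / b k"
            by (intro divide_right_mono) auto
          then show "\<bar>v x k * (v t k - v x k) / b k\<bar> \<le> C\<^sub>1 * (C\<^sub>2 * \<epsilon> * L n) * (1 / b k)"
            by (simp add: abs_mult)
        qed
        also have "\<dots> = C\<^sub>1 * C\<^sub>2 * (\<epsilon> * L n) * L n"
          unfolding sum_distrib_left[symmetric] L_def[of n, symmetric] by (simp add: mult_ac)
        \<comment> \<open>One factor L_n is spent on \<epsilon> L_n <= \<delta>, the other is
          compared with K_n(x, x).\<close>
        also have "\<dots> \<le> C\<^sub>1 * C\<^sub>2 * \<delta> * (\<kappa> * K n x x)"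
          using C1(1) C2(1) \<epsilon> Ln LK Lpos \<delta> by (intro mult_mono) (auto simp: field_simps)
        also have "\<dots> = K n x x / 2" using C1(1) C2(1) \<kappa>(1) by (simp add: \<delta>_def field_simps)
        finally show ?thesis by linarith
      qed
      have "measure M ?J \<le> measure M {t \<in> space M. \<bar>K n x t\<bar> \<ge> K n x x / 2}"
        using Q K_measurable sets space by (intro finite_measure_mono) auto
      also have "\<dots> \<le> (\<integral>t. (K n x t)\<^sup>2 \<partial>M) / (K n x x / 2)\<^sup>2"
        using K_square_integral[OF M] K_measurable[of n x] Kpos sets
        by (intro second_moment_method) (auto cong: measurable_cong_sets)
      also have "\<dots> = 4 / K n x x"
        using K_square_integral[OF M] Kpos by (simp add: power2_eq_square field_simps)
      also have "\<dots> \<le> 4 * \<kappa> / L n" using LK Kpos Lpos by (simp add: field_simps)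
      also have "\<dots> \<le> 4 * \<kappa> / (\<delta> / (2 * \<epsilon>))"
        using Ln' \<delta> \<epsilon> \<kappa>(1) Lpos by (intro divide_left_mono) auto
      also have "\<dots> = 8 * \<kappa> / \<delta> * \<epsilon>" using \<delta> by simp
      also have "\<dots> \<le> C * \<epsilon>" using \<epsilon> by (intro mult_right_mono) (auto simp: C_def)
      finally show ?thesis .
    qed
  qed
qed

lemma orth_measure_absolutely_continuous:
  assumes M: "orth_measure a b M" and div: "\<not> summable (\<lambda>n. 1 / b n)"
  shows "absolutely_continuous lborel M"
proof (rule absolutely_continuous_if_interval_bound)
  show fin: "finite_measure M" using orth_measure_prob_space[OF M] by (simp add: prob_space_def)
  show sets: "sets M = sets borel" using M by (simp add: orth_measure_def)
  interpret finite_measure M by (rule fin)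
  fix X :: real
  obtain C where C: "C > 0" "\<And>x \<epsilon>. \<lbrakk>\<bar>x\<bar> \<le> X; 0 < \<epsilon>\<rbrakk> \<Longrightarrow> measure M {x - \<epsilon>..x + \<epsilon>} \<le> C * \<epsilon>"
    using orth_measure_small_interval[OF M div] by blast
  have "measure M {c..d} \<le> C * (d - c)" if cd: "- X \<le> c" "c \<le> d" "d \<le> X" for c d
  proof (rule field_le_epsilon)
    fix e :: real assume e: "e > 0"
    \<comment> \<open>Half the length plus a margin: the margin keeps the radius positive when c = d
      and costs only \<open>e\<close> after multiplication by \<open>C\<close>.\<close>
    define \<epsilon> where "\<epsilon> = (d - c) / 2 + e / C"
    have \<epsilon>: "(d - c) / 2 < \<epsilon>" using e C(1) by (simp add: \<epsilon>_def)
    have "measure M {c..d} \<le> measure M {(c + d) / 2 - \<epsilon>..(c + d) / 2 + \<epsilon>}"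
      using sets \<epsilon> by (intro finite_measure_mono) (auto simp: field_simps)
    also have "\<dots> \<le> C * \<epsilon>" using cd \<epsilon> by (intro C(2)) (auto simp: abs_le_iff)
    also have "\<dots> = C * ((d - c) / 2) + e" using C(1) by (simp add: \<epsilon>_def algebra_simps)
    also have "\<dots> \<le> C * (d - c) + e" using C(1) cd by (intro add_right_mono mult_left_mono) auto
    finally show "measure M {c..d} \<le> C * (d - c) + e" .
  qed
  then show "\<exists>C. \<forall>c d. - X \<le> c \<longrightarrow> c \<le> d \<longrightarrow> d \<le> X \<longrightarrow> measure M {c..d} \<le> C * (d - c)" by blast
qed

end

section \<open>Existence of an orthogonality measure\<close>

lemma truncation_error:
  fixes f :: "'a \<Rightarrow> real"
  assumes "prob_space M" and f [measurable]: "f \<in> borel_measurable M"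
    and sq: "integrable M (\<lambda>x. (f x)\<^sup>2)" "(\<integral>x. (f x)\<^sup>2 \<partial>M) \<le> C" and R: "R > 0"
  shows "\<bar>(\<integral>x. f x \<partial>M) - (\<integral>x. max (- R) (min R (f x)) \<partial>M)\<bar> \<le> C / R"
proof -
  interpret prob_space M by fact
  have int: "integrable M f" using f sq(1) by (rule square_integrable_imp_integrable)
  have intT: "integrable M (\<lambda>x. max (- R) (min R (f x)))"
    by (rule integrable_const_bound[where B = R]) (use R in auto)
  \<comment> \<open>Truncation changes f only where |f| > R, and there |f| <= f^2 / R.\<close>
  have pw: "\<bar>f x - max (- R) (min R (f x))\<bar> \<le> (f x)\<^sup>2 / R" for x
  proof (cases "\<bar>f x\<bar> \<le> R")
    case True
    then show ?thesis using R by (auto simp: abs_le_iff max_def min_def)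
  next
    case False
    then have "\<bar>f x - max (- R) (min R (f x))\<bar> \<le> \<bar>f x\<bar>" using R by (auto simp: max_def min_def)
    also have "\<dots> * R \<le> (f x)\<^sup>2"
      using mult_left_mono[of R "\<bar>f x\<bar>" "\<bar>f x\<bar>"] False by (simp add: power2_eq_square)
    then have "\<bar>f x\<bar> \<le> (f x)\<^sup>2 / R" using R by (simp add: pos_le_divide_eq)
    finally show ?thesis .
  qed
  have "\<bar>(\<integral>x. f x \<partial>M) - (\<integral>x. max (- R) (min R (f x)) \<partial>M)\<bar>
      = \<bar>\<integral>x. f x - max (- R) (min R (f x)) \<partial>M\<bar>"
    using int intT by (simp add: Bochner_Integration.integral_diff)
  also have "\<dots> \<le> (\<integral>x. \<bar>f x - max (- R) (min R (f x))\<bar> \<partial>M)" by (rule integral_abs_bound)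
  also have "\<dots> \<le> (\<integral>x. (f x)\<^sup>2 / R \<partial>M)"
    using int intT sq(1) pw
    by (intro integral_mono integrable_abs Bochner_Integration.integrable_diff integrable_divide_zero) auto
  also have "\<dots> \<le> C / R" using sq(2) R by (simp add: divide_right_mono)
  finally show ?thesis .
qed

text \<open>Fatou's lemma for weak convergence: the truncations min (r, f^2) are bounded and
  continuous, so their integrals pass to the limit, and monotone convergence in r restores
  f^2.\<close>

lemma weak_limit_square_integrable:
  fixes f :: "real \<Rightarrow> real"
  assumes \<mu>: "\<And>n. real_distribution (\<mu> n)" and M: "real_distribution M" and conv: "weak_conv_m \<mu> M"
    and cont: "\<And>x. isCont f x"
    and sq: "\<forall>\<^sub>F n in sequentially. integrable (\<mu> n) (\<lambda>x. (f x)\<^sup>2) \<and> (\<integral>x. (f x)\<^sup>2 \<partial>\<mu> n) \<le> C"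
  shows "integrable M (\<lambda>x. (f x)\<^sup>2)" "(\<integral>x. (f x)\<^sup>2 \<partial>M) \<le> C"
proof -
  interpret M: real_distribution M by fact
  have "continuous_on UNIV f" using cont by (simp add: continuous_at_imp_continuous_on)
  then have fb [measurable]: "f \<in> borel_measurable borel" by (rule borel_measurable_continuous_onI)
  define G where "G r x = min (real r) ((f x)\<^sup>2)" for r :: nat and x
  have Gint: "integrable M (G r)" for r
    unfolding G_def by (rule M.integrable_const_bound[where B = "real r"]) auto
  have GC: "(\<integral>x. G r x \<partial>M) \<le> C" for r
  proof -
    have "(\<lambda>n. \<integral>x. G r x \<partial>\<mu> n) \<longlonglongrightarrow> (\<integral>x. G r x \<partial>M)"
    proof (rule weak_conv_imp_integral_bdd_continuous_conv[OF \<mu> M conv])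
      show "isCont (G r) x" for x unfolding G_def by (intro continuous_intros cont)
      show "norm (G r x) \<le> real r" for x by (simp add: G_def)
    qed
    moreover have "\<forall>\<^sub>F n in sequentially. (\<integral>x. G r x \<partial>\<mu> n) \<le> C"
      using sq
    proof eventually_elim
      case (elim n)
      interpret N: real_distribution "\<mu> n" by (rule \<mu>)
      have "integrable (\<mu> n) (G r)"
        unfolding G_def by (rule N.integrable_const_bound[where B = "real r"]) auto
      then have "(\<integral>x. G r x \<partial>\<mu> n) \<le> (\<integral>x. (f x)\<^sup>2 \<partial>\<mu> n)"
        using elim by (intro integral_mono) (auto simp: G_def)
      then show ?case using elim by linarith
    qed
    ultimately show ?thesis by (rule tendsto_upperbound) simp
  qed
  have Gmono: "incseq (\<lambda>r. \<integral>x. G r x \<partial>M)"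
    by (intro incseq_SucI integral_mono Gint) (auto simp: G_def)
  obtain I where I: "(\<lambda>r. \<integral>x. G r x \<partial>M) \<longlonglongrightarrow> I"
    using incseq_convergent[OF Gmono] GC by metis
  have lim: "(\<lambda>r. G r x) \<longlonglongrightarrow> (f x)\<^sup>2" for x
  proof (rule tendsto_eventually)
    obtain n :: nat where "(f x)\<^sup>2 \<le> real n" using real_arch_simple by blast
    then show "\<forall>\<^sub>F r in sequentially. G r x = (f x)\<^sup>2"
      unfolding eventually_sequentially G_def by (intro exI[of _ n]) auto
  qed
  have Gpt: "mono (\<lambda>r. G r x)" for x by (auto simp: G_def mono_def)
  have "has_bochner_integral M (\<lambda>x. (f x)\<^sup>2) I"
    by (rule has_bochner_integral_monotone_convergence[of M G])
      (use Gint I lim Gpt in auto)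
  moreover have "I \<le> C" using I GC by (intro LIMSEQ_le_const2) auto
  ultimately show "integrable M (\<lambda>x. (f x)\<^sup>2)" "(\<integral>x. (f x)\<^sup>2 \<partial>M) \<le> C"
    by (auto simp: has_bochner_integral_iff)
qed

text \<open>Bounded second moments give uniform integrability: cutting f off at level R costs at
  most C / R both along the sequence and in the limit, and the cut-off function is bounded and
  continuous.\<close>

lemma weak_limit_integral:
  fixes f :: "real \<Rightarrow> real"
  assumes \<mu>: "\<And>n. real_distribution (\<mu> n)" and M: "real_distribution M" and conv: "weak_conv_m \<mu> M"
    and cont: "\<And>x. isCont f x"
    and sq: "\<forall>\<^sub>F n in sequentially. integrable (\<mu> n) (\<lambda>x. (f x)\<^sup>2) \<and> (\<integral>x. (f x)\<^sup>2 \<partial>\<mu> n) \<le> C"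
    and eq: "\<forall>\<^sub>F n in sequentially. (\<integral>x. f x \<partial>\<mu> n) = I"
  shows "integrable M f" "(\<integral>x. f x \<partial>M) = I"
proof -
  interpret M: real_distribution M by fact
  have "continuous_on UNIV f" using cont by (simp add: continuous_at_imp_continuous_on)
  then have fb [measurable]: "f \<in> borel_measurable borel" by (rule borel_measurable_continuous_onI)
  note Msq = weak_limit_square_integrable[OF \<mu> M conv cont sq]
  show "integrable M f" using _ Msq(1) by (rule M.square_integrable_imp_integrable) simp
  have bound: "\<bar>(\<integral>x. f x \<partial>M) - I\<bar> \<le> 2 * C / R" if R: "R > 0" for R
  proof -
    let ?T = "\<lambda>x. max (- R) (min R (f x))"
    have "(\<lambda>n. \<integral>x. ?T x \<partial>\<mu> n) \<longlonglongrightarrow> (\<integral>x. ?T x \<partial>M)"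
    proof (rule weak_conv_imp_integral_bdd_continuous_conv[OF \<mu> M conv])
      show "isCont ?T x" for x by (intro continuous_intros cont)
      show "norm (?T x) \<le> R" for x using R by auto
    qed
    then have "(\<lambda>n. \<bar>I - (\<integral>x. ?T x \<partial>\<mu> n)\<bar>) \<longlonglongrightarrow> \<bar>I - (\<integral>x. ?T x \<partial>M)\<bar>" by (intro tendsto_intros)
    moreover have "\<forall>\<^sub>F n in sequentially. \<bar>I - (\<integral>x. ?T x \<partial>\<mu> n)\<bar> \<le> C / R"
      using sq eq
    proof eventually_elim
      case (elim n)
      interpret N: real_distribution "\<mu> n" by (rule \<mu>)
      show ?case
        using truncation_error[of "\<mu> n" f C R] elim R N.prob_space_axioms by simp
    qed
    ultimately have "\<bar>I - (\<integral>x. ?T x \<partial>M)\<bar> \<le> C / R" by (rule tendsto_upperbound) simp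
    moreover have "\<bar>(\<integral>x. f x \<partial>M) - (\<integral>x. ?T x \<partial>M)\<bar> \<le> C / R"
      by (rule truncation_error) (use Msq R M.prob_space_axioms in auto)
    ultimately show ?thesis by linarith
  qed
  show "(\<integral>x. f x \<partial>M) = I"
  proof (rule ccontr)
    let ?d = "\<bar>(\<integral>x. f x \<partial>M) - I\<bar>"
    assume "\<not> ?thesis"
    then have d: "?d > 0" by simp
    have "((\<lambda>R. 2 * C / R) \<longlongrightarrow> 0) at_top" by (intro tendsto_divide_0[OF tendsto_const] filterlim_at_top_imp_at_infinity filterlim_ident)
    then have "\<forall>\<^sub>F R in at_top. 2 * C / R < ?d" by (rule order_tendstoD) (rule d)
    then have "\<forall>\<^sub>F R in at_top. R > 0 \<and> 2 * C / R < ?d" using eventually_gt_at_top[of 0] by eventually_elim simp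
    then obtain R where "R > 0" "2 * C / R < ?d" using eventually_happens'[OF trivial_limit_at_top_linorder] by blast
    then show False using bound[of R] by linarith
  qed
qed

section \<open>Christoffel-Darboux formulas and zeros for a general Jacobi matrix\<close>

locale jacobi_matrix =
  fixes a b :: "nat \<Rightarrow> real"
  assumes a_pos: "\<And>n. 0 < n \<Longrightarrow> 0 < a n"
begin

abbreviation "p \<equiv> opoly a b"

lemma a_nz [simp]: "a (Suc n) \<noteq> 0" "0 < a (Suc n)"
  using a_pos[of "Suc n"] by auto

text \<open>A copy of \<open>opoly\<close> as genuine complex polynomials, for which degree,
  derivative and factorisation into linear factors are available.\<close>

fun P :: "nat \<Rightarrow> complex poly" where
  "P 0 = 1"
| "P (Suc 0) = Polynomial.smult (1 / of_real (a 1)) [:- of_real (b 0), 1:]"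
| "P (Suc (Suc n)) = Polynomial.smult (1 / of_real (a (Suc (Suc n))))
     ([:- of_real (b (Suc n)), 1:] * P (Suc n) - Polynomial.smult (of_real (a (Suc n))) (P n))"

lemma poly_P_of_real: "poly (P n) (of_real x) = of_real (p n x)"
  by (induction n rule: P.induct) (simp_all add: algebra_simps diff_divide_distrib add_divide_distrib)

lemma poly_P_cnj: "poly (P n) (cnj z) = cnj (poly (P n) z)"
  by (induction n rule: P.induct) (auto simp: algebra_simps)

lemma degree_P_aux: "degree (P n) \<le> n \<and> coeff (P n) n \<noteq> 0"
proof (induction n rule: P.induct)
  case 1
  then show ?case by simp
next
  case 2
  then show ?case using a_nz(1)[of 0] by simp
next
  case (3 n)
  have "degree ([:- of_real (b (Suc n)), 1:] * P (Suc n)) \<le> 1 + Suc n"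
    using 3 by (intro degree_mult_le[THEN order_trans] add_mono) auto
  moreover have "degree (Polynomial.smult (of_real (a (Suc n))) (P n)) \<le> Suc (Suc n)"
    using 3 degree_smult_le[of "of_real (a (Suc n))" "P n"] by linarith
  ultimately have "degree (P (Suc (Suc n))) \<le> Suc (Suc n)"
    unfolding P.simps by (intro degree_smult_le[THEN order_trans] degree_diff_le) auto
  \<comment> \<open>Only the product with the linear factor reaches degree n + 2, so the top
    coefficient is that of P_{n+1} divided by a_{n+2}.\<close>
  moreover have "coeff (P (Suc n)) (Suc (Suc n)) = 0" "coeff (P n) (Suc (Suc n)) = 0"
    using 3 by (auto intro!: coeff_eq_0)
  ultimately show ?case using 3 by simp
qed

lemma degree_P: "degree (P n) = n"
  using degree_P_aux[of n] le_degree[of "P n" n] by auto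

lemma P_nonzero: "P n \<noteq> 0"
  using degree_P_aux[of n] by auto

lemma a_P: "of_real (a (Suc (Suc n))) * poly (P (Suc (Suc n))) x
    = (x - of_real (b (Suc n))) * poly (P (Suc n)) x - of_real (a (Suc n)) * poly (P n) x"
  by (simp add: algebra_simps)

text \<open>When the recurrence is inserted for P_{n+2} at both points, the terms with b_{n+1}
  cancel by antisymmetry, and the new summand remains besides the expression for n.\<close>

lemma christoffel_darboux:
  "(x - y) * (\<Sum>k\<le>n. poly (P k) x * poly (P k) y) =
     of_real (a (Suc n)) * (poly (P (Suc n)) x * poly (P n) y - poly (P n) x * poly (P (Suc n)) y)"
proof (induction n)
  case 0
  then show ?case using a_nz(1)[of 0] by (simp add: field_simps)
next
  case (Suc n)
  let ?u = "\<lambda>k. poly (P k) x" and ?w = "\<lambda>k. poly (P k) y" and ?a = "\<lambda>k. complex_of_real (a k)"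
  have "?a (Suc (Suc n)) * (?u (Suc (Suc n)) * ?w (Suc n) - ?u (Suc n) * ?w (Suc (Suc n)))
    = (?a (Suc (Suc n)) * ?u (Suc (Suc n))) * ?w (Suc n) - ?u (Suc n) * (?a (Suc (Suc n)) * ?w (Suc (Suc n)))"
    by (simp add: algebra_simps del: P.simps)
  also have "\<dots> = (x - y) * (?u (Suc n) * ?w (Suc n)) + ?a (Suc n) * (?u (Suc n) * ?w n - ?u n * ?w (Suc n))"
    unfolding a_P by (simp add: algebra_simps del: P.simps)
  also have "\<dots> = (x - y) * (\<Sum>k\<le>Suc n. ?u k * ?w k)"
    unfolding Suc.IH[symmetric] by (simp add: algebra_simps del: P.simps)
  finally show ?case by simp
qed

text \<open>The limit y -> x of \<open>christoffel_darboux\<close>, obtained without limits by the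
  same induction from the differentiated recurrence.\<close>

lemma christoffel_darboux_confluent:
  "(\<Sum>k\<le>n. (poly (P k) x)\<^sup>2) =
     of_real (a (Suc n)) * (poly (pderiv (P (Suc n))) x * poly (P n) x - poly (pderiv (P n)) x * poly (P (Suc n)) x)"
proof (induction n)
  case 0
  then show ?case using a_nz(1)[of 0] by (simp add: field_simps pderiv_smult pderiv_pCons)
next
  case (Suc n)
  let ?u = "\<lambda>k. poly (P k) x" and ?d = "\<lambda>k. poly (pderiv (P k)) x" and ?a = "\<lambda>k. complex_of_real (a k)"
  have d: "?a (Suc (Suc n)) * ?d (Suc (Suc n)) = ?u (Suc n) + (x - of_real (b (Suc n))) * ?d (Suc n) - ?a (Suc n) * ?d n"
    by (simp add: pderiv_smult pderiv_diff pderiv_add pderiv_mult pderiv_pCons algebra_simps)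
  have "?a (Suc (Suc n)) * (?d (Suc (Suc n)) * ?u (Suc n) - ?d (Suc n) * ?u (Suc (Suc n)))
    = (?a (Suc (Suc n)) * ?d (Suc (Suc n))) * ?u (Suc n) - ?d (Suc n) * (?a (Suc (Suc n)) * ?u (Suc (Suc n)))"
    by (simp add: algebra_simps del: P.simps)
  also have "\<dots> = (?u (Suc n))\<^sup>2 + ?a (Suc n) * (?d (Suc n) * ?u n - ?d n * ?u (Suc n))"
    unfolding a_P d by (simp add: algebra_simps power2_eq_square del: P.simps)
  also have "\<dots> = (\<Sum>k\<le>Suc n. (?u k)\<^sup>2)"
    unfolding Suc.IH[symmetric] by (simp add: algebra_simps del: P.simps)
  finally show ?case by simp
qed

text \<open>The conjugate of a zero z is again a zero, so for nonreal z the Christoffel-Darboux sum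
  at the two points would vanish; but it is the sum of |P_k(z)|^2, whose summand for k = 0 is
  1.\<close>

lemma P_roots_real:
  assumes "poly (P (Suc n)) z = 0"
  shows "z \<in> \<real>"
proof (rule ccontr)
  assume "z \<notin> \<real>"
  then have "z - cnj z \<noteq> 0" by (simp add: complex_is_Real_iff complex_eq_iff)
  moreover have "(z - cnj z) * (\<Sum>k\<le>n. poly (P k) z * poly (P k) (cnj z)) = 0"
    unfolding christoffel_darboux using assms by (simp add: poly_P_cnj del: P.simps)
  ultimately have "(\<Sum>k\<le>n. poly (P k) z * poly (P k) (cnj z)) = 0" by simp
  then have "complex_of_real (\<Sum>k\<le>n. (cmod (poly (P k) z))\<^sup>2) = 0"
    by (simp only: of_real_sum poly_P_cnj complex_norm_square)
  then have "(\<Sum>k\<le>n. (cmod (poly (P k) z))\<^sup>2) = 0" by (simp only: of_real_eq_0_iff)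
  then have "cmod (poly (P 0) z) = 0" by (subst (asm) sum_nonneg_eq_0_iff) (auto simp del: P.simps)
  then show False by simp
qed

lemma sum_p_squares_pos: "0 < (\<Sum>k\<le>n. (p k x)\<^sup>2)"
  by (rule sum_pos2[of _ 0]) auto

text \<open>At a double zero, which is real, the confluent formula would force a sum of real squares
  containing p_0^2 = 1 to vanish.\<close>

lemma rsquarefree_P: "rsquarefree (P (Suc n))"
  unfolding rsquarefree_roots
proof (intro allI notI, elim conjE)
  fix z assume z: "poly (P (Suc n)) z = 0" "poly (pderiv (P (Suc n))) z = 0"
  obtain x where x: "z = of_real x" using P_roots_real[OF z(1)] by (auto elim: Reals_cases)
  have "(\<Sum>k\<le>n. (poly (P k) z)\<^sup>2) = 0"
    unfolding christoffel_darboux_confluent z by simp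
  then have "complex_of_real (\<Sum>k\<le>n. (p k x)\<^sup>2) = 0" by (simp add: x poly_P_of_real del: P.simps)
  then show False using sum_p_squares_pos[of x n] by (simp only: of_real_eq_0_iff)
qed

section \<open>Gauss quadrature at the zeros\<close>

definition nodes :: "nat \<Rightarrow> real set" where
  "nodes n = {x. p (Suc n) x = 0}"

text \<open>The Christoffel numbers. Rule n takes the n + 1 zeros of p_{n+1} and the polynomials
  p_0, ..., p_n, so nodes and polynomials are equal in number.\<close>

definition weight :: "nat \<Rightarrow> real \<Rightarrow> real" where
  "weight n x = 1 / (\<Sum>k\<le>n. (p k x)\<^sup>2)"

lemma weight_pos: "0 < weight n x"
  unfolding weight_def using sum_p_squares_pos by simp

lemma
  shows finite_nodes: "finite (nodes n)" and card_nodes: "card (nodes n) = Suc n"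
proof -
  let ?Z = "{z. poly (P (Suc n)) z = 0}"
  have Z: "?Z = complex_of_real ` nodes n"
  proof (intro equalityI subsetI)
    fix z assume "z \<in> ?Z"
    moreover from this have "z \<in> \<real>" using P_roots_real by blast
    then obtain x where "z = of_real x" by (rule Reals_cases)
    ultimately show "z \<in> complex_of_real ` nodes n" by (auto simp: nodes_def poly_P_of_real simp del: P.simps)
  qed (auto simp: nodes_def poly_P_of_real simp del: P.simps)
  have finZ: "finite ?Z" by (rule poly_roots_finite[OF P_nonzero])
  then show "finite (nodes n)" unfolding Z by (rule finite_imageD) (simp add: inj_on_def)
  \<comment> \<open>The zeros are simple, so the degree counts the linear factors of the
    factorisation.\<close>
  have "Suc n = degree (Polynomial.smult (lead_coeff (P (Suc n))) (\<Prod>z\<in>?Z. [:- z, 1:]))"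
    unfolding complex_poly_decompose_rsquarefree[OF rsquarefree_P] by (rule degree_P[symmetric])
  also have "\<dots> = degree (\<Prod>z\<in>?Z. [:- z, 1:])"
    using P_nonzero[of "Suc n"] by (simp del: P.simps)
  also have "\<dots> = card ?Z" by (subst degree_prod_eq_sum_degree) (auto simp del: P.simps)
  finally show "card (nodes n) = Suc n" unfolding Z by (simp add: card_image inj_on_def)
qed

text \<open>At two distinct zeros of p_{n+1} the right-hand side of the Christoffel-Darboux formula
  vanishes.\<close>

lemma node_orthogonality:
  assumes "x \<in> nodes n" "y \<in> nodes n" "x \<noteq> y"
  shows "(\<Sum>k\<le>n. p k x * p k y) = 0"
proof -
  have "complex_of_real ((x - y) * (\<Sum>k\<le>n. p k x * p k y)) = 0"
    using christoffel_darboux[of "of_real x" "of_real y" n] assms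
    by (simp add: poly_P_of_real nodes_def del: P.simps opoly.simps)
  then show ?thesis using assms(3) by (simp only: of_real_eq_0_iff) simp
qed

text \<open>By \<open>node_orthogonality\<close> the square matrix with entries sqrt (w(x_r))
  p_k(x_r) has orthonormal rows; hence its columns are orthonormal as well, and this is the discrete
  orthogonality.\<close>

lemma quadrature:
  assumes "i \<le> n" "j \<le> n"
  shows "(\<Sum>x\<in>nodes n. weight n x * (p i x * p j x)) = (if i = j then 1 else 0)"
proof -
  obtain h where h: "bij_betw h {0..<Suc n} (nodes n)"
    using ex_bij_betw_nat_finite[OF finite_nodes[of n]] card_nodes[of n] by auto
  then have hn: "h r \<in> nodes n" if "r < Suc n" for r using that by (auto simp: bij_betw_def)
  let ?s = "\<lambda>r. sqrt (weight n (h r))"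
  define A where "A = mat (Suc n) (Suc n) (\<lambda>(r, k). ?s r * p k (h r))"
  have A: "A \<in> carrier_mat (Suc n) (Suc n)" by (simp add: A_def)
  have "A * A\<^sup>T = 1\<^sub>m (Suc n)"
  proof (rule eq_matI)
    fix r q assume "r < dim_row (1\<^sub>m (Suc n) :: real mat)" "q < dim_col (1\<^sub>m (Suc n) :: real mat)"
    then have rq: "r < Suc n" "q < Suc n" by auto
    have "(A * A\<^sup>T) $$ (r, q) = (\<Sum>k<Suc n. (?s r * p k (h r)) * (?s q * p k (h q)))"
      using rq by (simp add: A_def scalar_prod_def atLeast0LessThan)
    also have "\<dots> = ?s r * ?s q * (\<Sum>k\<le>n. p k (h r) * p k (h q))"
      unfolding sum_distrib_left lessThan_Suc_atMost by (intro sum.cong) (auto simp: mult_ac)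
    also have "\<dots> = (if r = q then 1 else 0)"
    proof (cases "r = q")
      case True
      then show ?thesis
        using weight_pos[of n "h q"] sum_p_squares_pos[of "h q" n]
        by (simp add: weight_def power2_eq_square)
    next
      case False
      then have "h r \<noteq> h q" using h rq by (auto simp: bij_betw_def inj_on_def)
      then show ?thesis using node_orthogonality hn rq False by simp
    qed
    finally show "(A * A\<^sup>T) $$ (r, q) = 1\<^sub>m (Suc n) $$ (r, q)" using rq by simp
  qed (simp_all add: A_def)
  then have "A\<^sup>T * A = 1\<^sub>m (Suc n)"
    using A by (intro mat_mult_left_right_inverse[of A "Suc n"]) auto
  then have "(A\<^sup>T * A) $$ (i, j) = (if i = j then 1 else 0)" using assms by simp
  also have "(A\<^sup>T * A) $$ (i, j) = (\<Sum>r<Suc n. (?s r * p i (h r)) * (?s r * p j (h r)))"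
    using assms by (simp add: A_def scalar_prod_def atLeast0LessThan)
  also have "\<dots> = (\<Sum>r\<in>{0..<Suc n}. weight n (h r) * (p i (h r) * p j (h r)))"
  proof (intro sum.cong)
    fix r
    have "?s r * ?s r = weight n (h r)" using weight_pos[of n "h r"] by simp
    then show "(?s r * p i (h r)) * (?s r * p j (h r)) = weight n (h r) * (p i (h r) * p j (h r))"
      by (metis mult.assoc mult.left_commute)
  qed auto
  also have "\<dots> = (\<Sum>x\<in>nodes n. weight n x * (p i x * p j x))"
    by (rule sum.reindex_bij_betw[OF h])
  finally show ?thesis .
qed

text \<open>The image under the identity moves the point measure from the subsets of the node set to
  the Borel sets of the line.\<close>

definition gauss_measure :: "nat \<Rightarrow> real measure" where
  "gauss_measure n = distr (point_measure (nodes n) (\<lambda>x. ennreal (weight n x))) borel (\<lambda>x. x)"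

lemma gauss_measure_integral:
  fixes f :: "real \<Rightarrow> real"
  assumes "f \<in> borel_measurable borel"
  shows "integrable (gauss_measure n) f" "(\<integral>x. f x \<partial>gauss_measure n) = (\<Sum>x\<in>nodes n. weight n x * f x)"
proof -
  show "integrable (gauss_measure n) f"
    unfolding gauss_measure_def
    by (subst integrable_distr_eq) (use assms finite_nodes in \<open>auto intro: integrable_point_measure_finite\<close>)
  show "(\<integral>x. f x \<partial>gauss_measure n) = (\<Sum>x\<in>nodes n. weight n x * f x)"
    unfolding gauss_measure_def using assms finite_nodes weight_pos
    by (subst integral_distr) (auto simp: lebesgue_integral_point_measure_finite less_imp_le)
qed

lemma real_distribution_gauss_measure: "real_distribution (gauss_measure n)"
proof -
  have sets: "sets (gauss_measure n) = sets borel" "space (gauss_measure n) = UNIV"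
    by (simp_all add: gauss_measure_def)
  have int: "integrable (gauss_measure n) (\<lambda>_. 1 :: real)" by (rule gauss_measure_integral) simp
  then have "finite_measure (gauss_measure n)"
    by (intro finite_measureI) (simp add: integrable_iff_bounded less_top)
  then interpret finite_measure "gauss_measure n" .
  have "measure (gauss_measure n) (space (gauss_measure n)) = (\<integral>x. 1 \<partial>gauss_measure n)" by simp
  also have "\<dots> = 1" by (subst gauss_measure_integral(2)) (use quadrature[of 0 n 0] in auto)
  finally have "prob_space (gauss_measure n)" by (intro prob_spaceI) (simp add: emeasure_eq_measure)
  then show ?thesis using sets by (simp add: real_distribution_def real_distribution_axioms_def)
qed

section \<open>Expansions in the orthogonal polynomials and the limit measure\<close>

definition in_span :: "nat \<Rightarrow> (real \<Rightarrow> real) \<Rightarrow> bool" where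
  "in_span m f \<longleftrightarrow> (\<exists>c. \<forall>x. f x = (\<Sum>k\<le>m. c k * p k x))"

lemma in_span_p: "k \<le> m \<Longrightarrow> in_span m (p k)"
  unfolding in_span_def by (intro exI[of _ "\<lambda>i. if i = k then 1 else 0"]) (auto simp: if_distrib[of "\<lambda>c. c * _"] cong: if_cong)

lemma in_span_add: "in_span m f \<Longrightarrow> in_span m g \<Longrightarrow> in_span m (\<lambda>x. f x + g x)"
  unfolding in_span_def
proof (elim exE)
  fix c d assume "\<forall>x. f x = (\<Sum>k\<le>m. c k * p k x)" "\<forall>x. g x = (\<Sum>k\<le>m. d k * p k x)"
  then show "\<exists>c. \<forall>x. f x + g x = (\<Sum>k\<le>m. c k * p k x)"
    by (intro exI[of _ "\<lambda>k. c k + d k"]) (simp add: distrib_right sum.distrib)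
qed

lemma in_span_scale: "in_span m f \<Longrightarrow> in_span m (\<lambda>x. r * f x)"
  unfolding in_span_def
proof (elim exE)
  fix c assume "\<forall>x. f x = (\<Sum>k\<le>m. c k * p k x)"
  then show "\<exists>c. \<forall>x. r * f x = (\<Sum>k\<le>m. c k * p k x)"
    by (intro exI[of _ "\<lambda>k. r * c k"]) (simp add: sum_distrib_left mult.assoc)
qed

lemma in_span_sum: "(\<And>k. k \<in> A \<Longrightarrow> in_span m (f k)) \<Longrightarrow> in_span m (\<lambda>x. \<Sum>k\<in>A. f k x)"
proof (induction A rule: infinite_finite_induct)
  case (insert k A)
  then show ?case using in_span_add[of m "f k" "\<lambda>x. \<Sum>k\<in>A. f k x"] by simp
qed (auto simp: in_span_def intro!: exI[of _ "\<lambda>_. 0"])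

lemma in_span_mono:
  assumes "in_span m f" "m \<le> m'"
  shows "in_span m' f"
proof -
  obtain c where c: "\<And>x. f x = (\<Sum>k\<le>m. c k * p k x)" using assms(1) by (auto simp: in_span_def)
  have "in_span m' (\<lambda>x. \<Sum>k\<le>m. c k * p k x)"
    using assms(2) by (intro in_span_sum in_span_scale in_span_p) auto
  then show ?thesis unfolding c[symmetric] .
qed

lemma in_span_x_p: "in_span (Suc k) (\<lambda>x. x * p k x)"
proof (cases k)
  case 0
  have "(\<lambda>x. x * p k x) = (\<lambda>x. a 1 * p (Suc 0) x + b 0 * p 0 x)"
    using a_nz(1)[of 0] by (simp add: 0)
  then show ?thesis using 0 by (simp only:) (intro in_span_add in_span_scale in_span_p, auto)
next
  case (Suc m)
  have "(\<lambda>x. x * p k x) = (\<lambda>x. a (Suc (Suc m)) * p (Suc (Suc m)) x + (b (Suc m) * p (Suc m) x + a (Suc m) * p m x))"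
    by (rule ext) (simp add: Suc field_simps)
  then show ?thesis using Suc by (simp only:) (intro in_span_add in_span_scale in_span_p, auto)
qed

lemma in_span_x:
  assumes "in_span m f"
  shows "in_span (Suc m) (\<lambda>x. x * f x)"
proof -
  obtain c where c: "\<And>x. f x = (\<Sum>k\<le>m. c k * p k x)" using assms by (auto simp: in_span_def)
  have "in_span (Suc m) (\<lambda>x. \<Sum>k\<le>m. c k * (x * p k x))"
    by (intro in_span_sum in_span_scale in_span_mono[OF in_span_x_p]) auto
  also have "(\<lambda>x. \<Sum>k\<le>m. c k * (x * p k x)) = (\<lambda>x. x * f x)"
    by (simp add: c sum_distrib_left mult_ac)
  finally show ?thesis .
qed

text \<open>The recurrence expresses p_{i+2} p_j through p_{i+1} p_j, its multiple by x, and p_i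
  p_j; multiplication by x raises the span by one.\<close>

lemma in_span_p_mult_p: "in_span (i + j) (\<lambda>x. p i x * p j x)"
proof (induction i rule: P.induct)
  case 1
  then show ?case by (simp add: in_span_p)
next
  case 2
  have "(\<lambda>x. p (Suc 0) x * p j x) = (\<lambda>x. 1 / a 1 * (x * p j x) + - b 0 / a 1 * p j x)"
    by (rule ext) (simp add: field_simps)
  moreover have "in_span (Suc j) \<dots>"
    by (intro in_span_add in_span_scale in_span_x_p in_span_p) auto
  ultimately show ?case by simp
next
  case (3 n)
  have "(\<lambda>x. p (Suc (Suc n)) x * p j x) = (\<lambda>x. 1 / a (Suc (Suc n)) * (x * (p (Suc n) x * p j x)) +
      (- b (Suc n) / a (Suc (Suc n)) * (p (Suc n) x * p j x) + - a (Suc n) / a (Suc (Suc n)) * (p n x * p j x)))"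
    by (rule ext) (simp add: field_simps)
  moreover have "in_span (Suc (Suc n + j)) \<dots>"
    by (intro in_span_add in_span_scale in_span_x 3 in_span_mono[OF 3(1)] in_span_mono[OF 3(2)]) auto
  ultimately show ?case by simp
qed

text \<open>Parseval's identity for the discrete inner product. The value is the same for all n >=
  m, which provides the uniform second moments for tightness and for the weak limit.\<close>

lemma gauss_measure_square_integral:
  assumes "\<And>x. f x = (\<Sum>k\<le>m. c k * p k x)" "m \<le> n"
  shows "(\<integral>x. (f x)\<^sup>2 \<partial>gauss_measure n) = (\<Sum>k\<le>m. (c k)\<^sup>2)"
proof -
  have fm: "f \<in> borel_measurable borel" unfolding assms(1)[abs_def] by measurable
  have "(\<integral>x. (f x)\<^sup>2 \<partial>gauss_measure n) = (\<Sum>x\<in>nodes n. weight n x * (f x)\<^sup>2)"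
    using fm by (intro gauss_measure_integral) auto
  also have "\<dots> = (\<Sum>x\<in>nodes n. \<Sum>k\<le>m. \<Sum>l\<le>m. c k * c l * (weight n x * (p k x * p l x)))"
  proof -
    have "(f x)\<^sup>2 = (\<Sum>k\<le>m. \<Sum>l\<le>m. c k * c l * (p k x * p l x))" for x
      unfolding assms(1) power2_eq_square sum_product by (intro sum.cong refl) (simp add: mult_ac)
    then show ?thesis by (simp add: sum_distrib_left mult_ac)
  qed
  also have "\<dots> = (\<Sum>k\<le>m. \<Sum>l\<le>m. \<Sum>x\<in>nodes n. c k * c l * (weight n x * (p k x * p l x)))"
    by (subst sum.swap, rule sum.cong[OF refl], subst sum.swap) simp
  also have "\<dots> = (\<Sum>k\<le>m. \<Sum>l\<le>m. c k * c l * (if k = l then 1 else 0))"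
    unfolding sum_distrib_left[symmetric] using assms(2) by (intro sum.cong refl) (simp add: quadrature)
  also have "\<dots> = (\<Sum>k\<le>m. (c k)\<^sup>2)"
    by (simp add: power2_eq_square if_distrib[of "\<lambda>z. _ * z"] cong: if_cong)
  finally show ?thesis .
qed

text \<open>Expanding x in p_0 and p_1 shows that all these measures have the same second moment,
  and Chebyshev's inequality applies. The shift of the index ensures that p_1 is within reach of
  every rule.\<close>

lemma tight_gauss_measure: "tight (\<lambda>n. gauss_measure (Suc n))"
  unfolding tight_def
proof (intro conjI allI impI)
  show "real_distribution (gauss_measure (Suc n))" for n by (rule real_distribution_gauss_measure)
  fix e :: real assume e: "e > 0"
  obtain c where c: "\<And>x. x * p 0 x = (\<Sum>k\<le>Suc 0. c k * p k x)"
    using in_span_x_p[of 0] by (auto simp: in_span_def)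
  define s where "s = (\<Sum>k\<le>Suc 0. (c k)\<^sup>2)"
  \<comment> \<open>The added 1 makes \<open>R\<close> positive and the inequality s / R^2 < e
    strict.\<close>
  define R where "R = sqrt (s / e) + 1"
  have s0: "0 \<le> s" unfolding s_def by (rule sum_nonneg) simp
  then have R0: "0 < R" using e by (simp add: R_def add_nonneg_pos)
  have "s / e < R\<^sup>2"
  proof -
    have "s / e = (sqrt (s / e))\<^sup>2" using s0 e by simp
    also have "\<dots> < R\<^sup>2" unfolding R_def using s0 e by (intro power_strict_mono) auto
    finally show ?thesis .
  qed
  then have sR: "s / R\<^sup>2 < e" using e R0 by (simp add: field_simps)
  have "1 - e < measure (gauss_measure (Suc n)) {- R<..R}" for n
  proof -
    interpret real_distribution "gauss_measure (Suc n)" by (rule real_distribution_gauss_measure)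
    have "(\<integral>x. x\<^sup>2 \<partial>gauss_measure (Suc n)) = s"
      using gauss_measure_square_integral[OF c, of "Suc n"] by (simp add: s_def)
    moreover have "integrable (gauss_measure (Suc n)) (\<lambda>x. x\<^sup>2)" by (rule gauss_measure_integral) simp
    ultimately have "measure (gauss_measure (Suc n)) {x \<in> space (gauss_measure (Suc n)). \<bar>x\<bar> \<ge> R} \<le> s / R\<^sup>2"
      using second_moment_method[of "\<lambda>x. x" R] R0 by simp
    moreover have "1 - measure (gauss_measure (Suc n)) {- R<..R} = prob (space (gauss_measure (Suc n)) - {- R<..R})"
      by (subst prob_compl) auto
    moreover have "\<dots> \<le> measure (gauss_measure (Suc n)) {x \<in> space (gauss_measure (Suc n)). \<bar>x\<bar> \<ge> R}"
      by (rule finite_measure_mono) auto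
    ultimately show ?thesis using sR by linarith
  qed
  moreover have "- R < R" using R0 by simp
  ultimately show "\<exists>a b. a < b \<and> (\<forall>n. 1 - e < measure (gauss_measure (Suc n)) {a<..b})" by blast
qed

text \<open>The products p_i p_j are unbounded, but their expansion in p_0, ..., p_{i+j} bounds
  their second moments uniformly, so their integrals pass to a weak limit of the Gauss
  measures.\<close>

lemma favard: "\<exists>M. orth_measure a b M"
proof -
  obtain r M where r: "strict_mono (r :: nat \<Rightarrow> nat)" and M: "real_distribution M"
    and conv: "weak_conv_m ((\<lambda>n. gauss_measure (Suc n)) \<circ> id \<circ> r) M"
    using tight_imp_convergent_subsubsequence[OF tight_gauss_measure strict_mono_id] by blast
  define \<mu> where "\<mu> n = gauss_measure (Suc (r n))" for n
  have conv: "weak_conv_m \<mu> M" using conv by (simp add: \<mu>_def[abs_def] comp_def)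
  have r_ge: "n \<le> r n" for n using r by (rule strict_mono_imp_increasing)
  interpret M: real_distribution M by (rule M)
  have "integrable M (\<lambda>x. p i x * p j x) \<and> (\<integral>x. p i x * p j x \<partial>M) = (if i = j then 1 else 0)" for i j
  proof -
    obtain c where c: "\<And>x. p i x * p j x = (\<Sum>k\<le>i + j. c k * p k x)"
      using in_span_p_mult_p[of i j] by (auto simp: in_span_def)
    have sq: "\<forall>\<^sub>F n in sequentially. integrable (\<mu> n) (\<lambda>x. (p i x * p j x)\<^sup>2) \<and>
        (\<integral>x. (p i x * p j x)\<^sup>2 \<partial>\<mu> n) \<le> (\<Sum>k\<le>i + j. (c k)\<^sup>2)"
      using eventually_ge_at_top[of "i + j"]
    proof eventually_elim
      case (elim n)
      then have "i + j \<le> Suc (r n)" using r_ge[of n] by linarith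
      then show ?case unfolding \<mu>_def
        using gauss_measure_square_integral[OF c, of "Suc (r n)"]
        by (auto intro!: gauss_measure_integral)
    qed
    have eq: "\<forall>\<^sub>F n in sequentially. (\<integral>x. p i x * p j x \<partial>\<mu> n) = (if i = j then 1 else 0)"
      using eventually_ge_at_top[of "i + j"]
    proof eventually_elim
      case (elim n)
      then have "i \<le> Suc (r n)" "j \<le> Suc (r n)" using r_ge[of n] by linarith+
      then show ?case unfolding \<mu>_def by (subst gauss_measure_integral(2)) (auto simp: quadrature)
    qed
    have "isCont (\<lambda>x. p i x * p j x) x" for x by (intro isCont_mult isCont_opoly)
    then show ?thesis
      using weak_limit_integral[OF _ M conv _ sq eq] real_distribution_gauss_measure
      unfolding \<mu>_def by blast
  qed
  then show ?thesis unfolding orth_measure_def by (intro exI[of _ M]) auto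
qed

end

theorem theorem3p1:
  fixes b :: "nat \<Rightarrow> real" and B :: real
  assumes mono_b: "incseq b \<or> decseq b"
    and pos: "\<And>n. b n > 0"
    and infty: "filterlim b at_top sequentially"
    and ratio: "(\<lambda>n. b (Suc n) / b n) \<longlonglongrightarrow> 1"
    and div: "\<not> summable (\<lambda>n. 1 / b n)"
    and B: "0 < B" "B < 1"
  shows "(\<exists>M. orth_measure (jac_offdiag B b) b M)
    \<and> (\<forall>M. orth_measure (jac_offdiag B b) b M \<longrightarrow> absolutely_continuous lborel M)
    \<and> (\<forall>l u :: real. \<exists>C. \<forall>n. \<forall>x \<in> {l..u}.
          (opoly (jac_offdiag B b) b n x)\<^sup>2 \<le> C / b n)"
proof -
  \<comment> \<open>A decreasing sequence would be bounded by b_0, against b_n -> infinity.\<close>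
  have inc: "incseq b"
    using mono_b
  proof
    assume dec: "decseq b"
    have "\<forall>\<^sub>F n in sequentially. b 0 + 1 \<le> b n" using infty by (simp add: filterlim_at_top)
    then obtain n where "b 0 + 1 \<le> b n" by (auto simp: eventually_sequentially)
    moreover have "b n \<le> b 0" using dec by (simp add: decseq_def)
    ultimately show ?thesis by simp
  qed
  interpret W: jacobi_weights b B
    by unfold_locales (use inc pos infty B in auto)
  interpret J: jacobi_matrix "jac_offdiag B b" b
    by unfold_locales (use B in \<open>simp add: jac_offdiag_def\<close>)
  show ?thesis
    using J.favard W.orth_measure_absolutely_continuous[OF _ div] W.poly_bound by blast
qed

end
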